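(* Let $z\in C^{0,1}([0,T];\mathcal Z)$ be a differential solution of the rate-independent system. Let $\mathcal I$ be locally $\kappa$-uniformly convex around $z$ with radius $\Delta>0$ (for some $\kappa>0$), and assume that $\ell\in W^{1,\infty}([0,T];\mathcal V^* )$ with $|\ell|_{Lip}\le\kappa-\delta$ for some $\delta\in(0,\kappa]$, and $\ell'\in BV([0,T];\mathcal V^* )$. Then there exist a constant $K_{loc}>0$, independent of $\tau$, and a sufficiently small $\bar\tau>0$ such that for all $0<\tau\le\bar\tau$ the back-transformed discrete parameterized solution $z_\tau:[0,T]\to\mathcal Z$ satisfies $$\|z_\tau(t)-z(t)\|_{\mathcal Z}\le K_{loc}\,\tau\qquad\text{for all }t\in[0,T].$$
   Context: Setting. Let $T>0$. $\mathcal X$ is a Banach space and $\mathcal Z,\mathcal V$ are Hilbert spaces (all real) with $\mathcal Z\hookrightarrow\mathcal V$ densely and compactly and $\mathcal V\hookrightarrow\mathcal X$ continuously; the embedding constant of $\mathcal Z\hookrightarrow\mathcal V$ is normalized to $1$, i.e. $\|v\|_{\mathcal V}\le\|v\|_{\mathcal Z}$. Energy: $\mathcal I:[0,T]\times\mathcal Z\to\mathbb R$, $\mathcal I(t,z)=\frac12\langle Az,z\rangle_{\mathcal Z^*,\mathcal Z}+\mathcal F(z)-\langle \ell(t),z\rangle_{\mathcal V^*,\mathcal V}$, where $A\in\mathcal L(\mathcal Z,\mathcal Z^* )$ is self-adjoint with $\langle Az,z\rangle\ge\alpha\|z\|_{\mathcal Z}^2$ for some $\alpha>0$; $\ell\in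 C^{0,1}([0,T];\mathcal V^* )$ with Lipschitz constant $|\ell|_{Lip}$; $\mathcal F\in C^2(\mathcal Z;\mathbb R)$, $\mathcal F\ge0$, $D_z\mathcal F\in C^1(\mathcal Z,\mathcal V^* )$ and $\|D_z^2\mathcal F(z)v\|_{\mathcal V^*}\le C_{\mathcal F}(1+\|z\|_{\mathcal Z}^q)\|v\|_{\mathcal Z}$ for some $q\ge1$. Moreover $\mathcal I(t,\cdot)\in C^{2,1}_{loc}(\mathcal Z;\mathbb R)$: for every $r>0$ there is $C(r)\ge0$ with $\langle[D_z^2\mathcal I(t,z_1)-D_z^2\mathcal I(t,z_2)]v,v\rangle_{\mathcal Z^*,\mathcal Z}\le C(r)\|z_1-z_2\|_{\mathcal Z}\|v\|_{\mathcal Z}^2$ for all $z_1,z_2\in B_{\mathcal Z}(0,r)$, $v\in\mathcal Z$. Local $\kappa$-uniform convexity around $z:[0,T]\to\mathcal Z$ with radius $\Delta$: $\kappa,\Delta>0$ are independent of $t$ and $\langle D_z^2\mathcal I(t,\tilde z)v,v\rangle_{\mathcal Z^*,\mathcal Z}\ge\kappa\|v\|_{\mathcal Z}^2$ for all $t\in[0,T]$, all $\tilde z\in\overline{B_{\mathcal Z}(z(t),\Delta)}$ and all $v\in\mathcal Z$. (No global convexity is assumed.) Dissipation: $\mathcal R:\mathcal V\to[0,\infty)$ is lower semicontinuous, convex, positively homogeneous of degree one, and there are $\underline\rho,\overline\rho>0$ with $\underline\rho\|v\|_{\mathcal X}\le\mathcal R(v)\le\overline\rho\|v\|_{\mathcal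 V}$ for all $v\in\mathcal V$. For $w\in\mathcal Z$, $\xi\in\mathcal Z^*$, the inclusion $0\in\partial\mathcal R(w)+\xi$ means $\mathcal R(v)\ge\mathcal R(w)-\langle\xi,v-w\rangle_{\mathcal Z^*,\mathcal Z}$ for all $v\in\mathcal Z$ (equivalently, by density, $-\xi$ extends to an element of the subdifferential of $\mathcal R$ at $w$ in $\mathcal V^*$). Initial state: $z_0\in\mathcal Z$ with $0\in\partial\mathcal R(0)+D_z\mathcal I(0,z_0)$. Differential solution: $z\in W^{1,1}(0,T;\mathcal Z)$ with $z(0)=z_0$ and $0\in\partial\mathcal R(z'(t))+D_z\mathcal I(t,z(t))$ for almost all $t\in[0,T]$. Local incremental minimization scheme: for $\tau>0$ put $t_0=0$ and, for $k\ge1$, let $z_k\in\arg\min\{\mathcal I(t_{k-1},z)+\mathcal R(z-z_{k-1}):z\in\mathcal Z,\ \|z-z_{k-1}\|_{\mathcal V}\le\tau\}$ (an arbitrary minimizer) and $t_k=\min\{t_{k-1}+\tau-\|z_k-z_{k-1}\|_{\mathcal V},T\}$. The iterates depend on $\tau$. $N(\tau)$ is the smallest index with $t_{N(\tau)}=T$ (it is finite). Back-transformed discrete parameterized solution $z_\tau:[0,T]\to\mathcal Z$: the affine interpolant of the iterates in physical time, $z_\tau(t)=z_{k-1}+\frac{t-t_{k-1}}{t_k-t_{k-1}}(z_k-z_{k-1})$ for $t\in[t_{k-1},t_k)$, $1\le k\le N(\tau)$, and $z_\tau(T)=z_{N(\tau)}$. (Under the hypotheses of the claim and for $\tau$ sufficiently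 small, $t_0<t_1<\dots<t_{N(\tau)}=T$.) *)

theory Defs
  imports "HOL-Analysis.Analysis"
begin

text \<open>
  The library's \<open>frechet_derivative\<close> packaged as a bounded operator; meaningful only at points
  of differentiability. For real-valued functions it takes values in the dual space
  \<open>'a \<Rightarrow>\<^sub>L real\<close>, and iterating it gives the second derivative with values in
  \<open>'a \<Rightarrow>\<^sub>L ('a \<Rightarrow>\<^sub>L real)\<close>.
\<close>

definition fderiv :: "('a::real_normed_vector \<Rightarrow> 'b::real_normed_vector) \<Rightarrow> 'a \<Rightarrow> 'a \<Rightarrow>\<^sub>L 'b" where
  "fderiv f x = Blinfun (frechet_derivative f (at x))"

definition C1_map :: "('a::real_normed_vector \<Rightarrow> 'b::real_normed_vector) \<Rightarrow> bool" where
  "C1_map f \<longleftrightarrow> (\<forall>x. f differentiable (at x)) \<and> continuous_on UNIV (fderiv f)"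

definition C2_map :: "('a::real_normed_vector \<Rightarrow> 'b::real_normed_vector) \<Rightarrow> bool" where
  "C2_map f \<longleftrightarrow> C1_map f \<and> C1_map (fderiv f)"

text \<open>The optimal Lipschitz constant; only meaningful for Lipschitz functions.\<close>

definition lipschitz_const :: "'a::metric_space set \<Rightarrow> ('a \<Rightarrow> 'b::metric_space) \<Rightarrow> real" where
  "lipschitz_const S f = Inf {L. L-lipschitz_on S f}"

text \<open>
  Strong (Bochner) measurability. The library's Bochner integral requires a second countable
  value type, which is not available for the dual space \<open>'v \<Rightarrow>\<^sub>L real\<close>. So Bochner
  integrability is expressed as strong measurability plus integrability of the norm, and the
  value of the integral by the gauge integral \<open>has_integral\<close>, which agrees with the Bochner
  integral on Bochner integrable functions.
\<close>

definition strongly_measurable_on :: "real set \<Rightarrow> (real \<Rightarrow> 'a::real_normed_vector) \<Rightarrow> bool" where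
  "strongly_measurable_on S g \<longleftrightarrow>
     (\<exists>s. (\<forall>n::nat. simple_function (lebesgue_on S) (s n)) \<and>
          (AE t in lebesgue_on S. (\<lambda>n. s n t) \<longlonglongrightarrow> g t))"

text \<open>
  \<open>f\<close> is the continuous representative of a function in \<open>W^{1,1}(0,T)\<close>, respectively
  \<open>W^{1,\<infinity>}(0,T)\<close>, and \<open>g\<close> is its weak derivative (unique up to null sets).
\<close>

definition W11_deriv ::
  "real \<Rightarrow> (real \<Rightarrow> 'a::real_normed_vector) \<Rightarrow> (real \<Rightarrow> 'a) \<Rightarrow> bool" where
  "W11_deriv T f g \<longleftrightarrow>
     strongly_measurable_on {0..T} g \<and> (\<lambda>t. norm (g t)) absolutely_integrable_on {0..T} \<and>
     (\<forall>t\<in>{0..T}. (g has_integral (f t - f 0)) {0..t})"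

definition W1inf_deriv ::
  "real \<Rightarrow> (real \<Rightarrow> 'a::real_normed_vector) \<Rightarrow> (real \<Rightarrow> 'a) \<Rightarrow> bool" where
  "W1inf_deriv T f g \<longleftrightarrow>
     strongly_measurable_on {0..T} g \<and> (\<exists>M. AE t in lebesgue_on {0..T}. norm (g t) \<le> M) \<and>
     (\<forall>t\<in>{0..T}. (g has_integral (f t - f 0)) {0..t})"

definition bounded_pointwise_variation_on ::
  "real set \<Rightarrow> (real \<Rightarrow> 'a::real_normed_vector) \<Rightarrow> bool" where
  "bounded_pointwise_variation_on S g \<longleftrightarrow>
     (\<exists>M. \<forall>n. \<forall>p::nat \<Rightarrow> real. mono_on {..n} p \<longrightarrow> p ` {..n} \<subseteq> S \<longrightarrow>
        (\<Sum>i<n. norm (g (p (Suc i)) - g (p i))) \<le> M)"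

text \<open>
  BV for classes of functions modulo null sets: some representative has bounded pointwise
  variation.
\<close>

definition BV_on :: "real set \<Rightarrow> (real \<Rightarrow> 'a::real_normed_vector) \<Rightarrow> bool" where
  "BV_on S g \<longleftrightarrow>
     (\<exists>h. bounded_pointwise_variation_on S h \<and> (AE t in lebesgue_on S. h t = g t))"

text \<open>
  \<open>j\<close> is the embedding of \<open>'z\<close> into \<open>'v\<close>. The restriction of a functional
  \<open>\<xi>\<close> in the dual of \<open>'v\<close> to \<open>'z\<close> is \<open>\<xi> o\<^sub>L j\<close>.
\<close>

definition energy ::
  "('z::real_normed_vector \<Rightarrow>\<^sub>L 'v::real_normed_vector) \<Rightarrow> ('z \<Rightarrow>\<^sub>L ('z \<Rightarrow>\<^sub>L real)) \<Rightarrow>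
   ('z \<Rightarrow> real) \<Rightarrow> (real \<Rightarrow> 'v \<Rightarrow>\<^sub>L real) \<Rightarrow> real \<Rightarrow> 'z \<Rightarrow> real" where
  "energy j A F l t z = 1/2 * blinfun_apply (blinfun_apply A z) z + F z
     - blinfun_apply (l t) (blinfun_apply j z)"

definition D_energy ::
  "('z::real_normed_vector \<Rightarrow>\<^sub>L 'v::real_normed_vector) \<Rightarrow> ('z \<Rightarrow>\<^sub>L ('z \<Rightarrow>\<^sub>L real)) \<Rightarrow>
   ('z \<Rightarrow> real) \<Rightarrow> (real \<Rightarrow> 'v \<Rightarrow>\<^sub>L real) \<Rightarrow> real \<Rightarrow> 'z \<Rightarrow> ('z \<Rightarrow>\<^sub>L real)" where
  "D_energy j A F l t = fderiv (energy j A F l t)"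

definition D2_energy ::
  "('z::real_normed_vector \<Rightarrow>\<^sub>L 'v::real_normed_vector) \<Rightarrow> ('z \<Rightarrow>\<^sub>L ('z \<Rightarrow>\<^sub>L real)) \<Rightarrow>
   ('z \<Rightarrow> real) \<Rightarrow> (real \<Rightarrow> 'v \<Rightarrow>\<^sub>L real) \<Rightarrow> real \<Rightarrow> 'z \<Rightarrow> ('z \<Rightarrow>\<^sub>L ('z \<Rightarrow>\<^sub>L real))" where
  "D2_energy j A F l t = fderiv (D_energy j A F l t)"

definition lower_semicontinuous :: "('a::topological_space \<Rightarrow> real) \<Rightarrow> bool" where
  "lower_semicontinuous f \<longleftrightarrow> (\<forall>x a. a < f x \<longrightarrow> (\<forall>\<^sub>F y in nhds x. a < f y))"

text \<open>The inclusion \<open>0 \<in> \<partial>R(w) + \<xi>\<close> for \<open>w\<close> in \<open>'z\<close> and \<open>\<xi>\<close> in the dual of \<open>'z\<close>.\<close>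

definition zero_in_subdiff_plus ::
  "('z::real_normed_vector \<Rightarrow>\<^sub>L 'v::real_normed_vector) \<Rightarrow> ('v \<Rightarrow> real) \<Rightarrow> 'z \<Rightarrow> ('z \<Rightarrow>\<^sub>L real) \<Rightarrow> bool" where
  "zero_in_subdiff_plus j R w \<xi> \<longleftrightarrow>
     (\<forall>v. R (blinfun_apply j v) \<ge> R (blinfun_apply j w) - blinfun_apply \<xi> (v - w))"

text \<open>
  \<open>DF\<close> is the derivative of \<open>F\<close> regarded as a map into the dual of \<open>'v\<close>; since the range
  of \<open>j\<close> is dense, it is determined by \<open>F\<close>. Hilbert spaces are types of sort
  \<open>{real_inner, complete_space}\<close>.
\<close>

locale rate_independent_system =
  fixes T :: real
    and j :: "'z::{real_inner,complete_space} \<Rightarrow>\<^sub>L 'v::{real_inner,complete_space}"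
    and jX :: "'v \<Rightarrow>\<^sub>L 'x::banach"
    and A :: "'z \<Rightarrow>\<^sub>L ('z \<Rightarrow>\<^sub>L real)"
    and F :: "'z \<Rightarrow> real"
    and DF :: "'z \<Rightarrow> ('v \<Rightarrow>\<^sub>L real)"
    and l :: "real \<Rightarrow> ('v \<Rightarrow>\<^sub>L real)"
    and R :: "'v \<Rightarrow> real"
    and z0 :: 'z
  assumes T_pos: "T > 0"
    and j_inj: "inj (blinfun_apply j)"
    and j_dense: "closure (range (blinfun_apply j)) = UNIV"
    and j_compact: "\<And>B. bounded B \<Longrightarrow> compact (closure (blinfun_apply j ` B))"
    and j_normalized: "\<And>v. norm (blinfun_apply j v) \<le> norm v"
    and jX_inj: "inj (blinfun_apply jX)"
    and A_selfadjoint: "\<And>v w. blinfun_apply (blinfun_apply A v) w = blinfun_apply (blinfun_apply A w) v"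
    and A_coercive: "\<exists>\<alpha>>0. \<forall>v. blinfun_apply (blinfun_apply A v) v \<ge> \<alpha> * (norm v)\<^sup>2"
    and l_Lipschitz: "\<exists>L. L-lipschitz_on {0..T} l"
    and F_C2: "C2_map F"
    and F_nonneg: "\<And>v. F v \<ge> 0"
    and DF_deriv: "\<And>v. fderiv F v = DF v o\<^sub>L j"
    and DF_C1: "C1_map DF"
    and D2F_bound: "\<exists>C. \<exists>q\<ge>1. \<forall>u v.
          norm (blinfun_apply (fderiv DF u) v) \<le> C * (1 + norm u powr q) * norm v"
    and energy_C21_loc: "\<And>r. r > 0 \<Longrightarrow> \<exists>C\<ge>0. \<forall>t\<in>{0..T}. \<forall>z1\<in>ball 0 r. \<forall>z2\<in>ball 0 r. \<forall>v.
          blinfun_apply (blinfun_apply (D2_energy j A F l t z1 - D2_energy j A F l t z2) v) v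
            \<le> C * norm (z1 - z2) * (norm v)\<^sup>2"
    and R_nonneg: "\<And>v. R v \<ge> 0"
    and R_lsc: "lower_semicontinuous R"
    and R_convex: "convex_on UNIV R"
    and R_homogeneous: "\<And>c v. c > 0 \<Longrightarrow> R (c *\<^sub>R v) = c * R v"
    and R_bounds: "\<exists>\<rho>1>0. \<exists>\<rho>2>0. \<forall>v. \<rho>1 * norm (blinfun_apply jX v) \<le> R v \<and> R v \<le> \<rho>2 * norm v"
    and z0_stable: "zero_in_subdiff_plus j R 0 (D_energy j A F l 0 z0)"

definition locally_uniformly_convex ::
  "real \<Rightarrow> ('z::real_normed_vector \<Rightarrow>\<^sub>L 'v::real_normed_vector) \<Rightarrow> ('z \<Rightarrow>\<^sub>L ('z \<Rightarrow>\<^sub>L real)) \<Rightarrow>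
   ('z \<Rightarrow> real) \<Rightarrow> (real \<Rightarrow> 'v \<Rightarrow>\<^sub>L real) \<Rightarrow> real \<Rightarrow> real \<Rightarrow> (real \<Rightarrow> 'z) \<Rightarrow> bool" where
  "locally_uniformly_convex T j A F l \<kappa> \<Delta> z \<longleftrightarrow>
     (\<forall>t\<in>{0..T}. \<forall>u\<in>cball (z t) \<Delta>. \<forall>v.
        blinfun_apply (blinfun_apply (D2_energy j A F l t u) v) v \<ge> \<kappa> * (norm v)\<^sup>2)"

definition differential_solution ::
  "real \<Rightarrow> ('z::real_normed_vector \<Rightarrow>\<^sub>L 'v::real_normed_vector) \<Rightarrow> ('z \<Rightarrow>\<^sub>L ('z \<Rightarrow>\<^sub>L real)) \<Rightarrow>
   ('z \<Rightarrow> real) \<Rightarrow> (real \<Rightarrow> 'v \<Rightarrow>\<^sub>L real) \<Rightarrow> ('v \<Rightarrow> real) \<Rightarrow> 'z \<Rightarrow> (real \<Rightarrow> 'z) \<Rightarrow> bool" where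
  "differential_solution T j A F l R z0 z \<longleftrightarrow>
     (\<exists>z'. W11_deriv T z z' \<and> z 0 = z0 \<and>
        (AE t in lebesgue_on {0..T}. zero_in_subdiff_plus j R (z' t) (D_energy j A F l t (z t))))"

text \<open>
  \<open>zs\<close> and \<open>ts\<close> are the iterates and the physical times for step size \<open>\<tau>\<close>; at each step the
  minimizer is arbitrary.
\<close>

definition incremental_scheme ::
  "real \<Rightarrow> ('z::real_normed_vector \<Rightarrow>\<^sub>L 'v::real_normed_vector) \<Rightarrow> ('z \<Rightarrow>\<^sub>L ('z \<Rightarrow>\<^sub>L real)) \<Rightarrow>
   ('z \<Rightarrow> real) \<Rightarrow> (real \<Rightarrow> 'v \<Rightarrow>\<^sub>L real) \<Rightarrow> ('v \<Rightarrow> real) \<Rightarrow> 'z \<Rightarrow> real \<Rightarrow>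
   (nat \<Rightarrow> 'z) \<Rightarrow> (nat \<Rightarrow> real) \<Rightarrow> bool" where
  "incremental_scheme T j A F l R z0 \<tau> zs ts \<longleftrightarrow>
     zs 0 = z0 \<and> ts 0 = 0 \<and>
     (\<forall>k\<ge>1.
        is_arg_min (\<lambda>u. energy j A F l (ts (k - 1)) u + R (blinfun_apply j (u - zs (k - 1))))
                   (\<lambda>u. norm (blinfun_apply j (u - zs (k - 1))) \<le> \<tau>) (zs k) \<and>
        ts k = min (ts (k - 1) + \<tau> - norm (blinfun_apply j (zs k - zs (k - 1)))) T)"

definition final_index :: "real \<Rightarrow> (nat \<Rightarrow> real) \<Rightarrow> nat" where
  "final_index T ts = (LEAST k. ts k = T)"

text \<open>
  The times \<open>ts\<close> produced by the scheme are nondecreasing, so for \<open>0 \<le> t < T\<close> the index chosen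
  below is unique; it exists whenever \<open>T\<close> is reached in finitely many steps.
\<close>

definition back_transformed_solution ::
  "real \<Rightarrow> (nat \<Rightarrow> 'z::real_normed_vector) \<Rightarrow> (nat \<Rightarrow> real) \<Rightarrow> real \<Rightarrow> 'z" where
  "back_transformed_solution T zs ts t =
     (if t = T then zs (final_index T ts)
      else let k = (THE k. 1 \<le> k \<and> k \<le> final_index T ts \<and> t \<in> {ts (k - 1)..<ts k})
           in zs (k - 1) + ((t - ts (k - 1)) / (ts k - ts (k - 1))) *\<^sub>R (zs k - zs (k - 1)))"

end

theory Submission
  imports Defs
begin

text \<open>
  The constraint of the minimization problem is shown to be inactive: coercivity bounds each step in
  the norm of \<open>'z\<close> by a multiple of \<open>\<tau>\<close>, so it stays in the region of uniform convexity, and there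
  the condition on the Lipschitz constant of \<open>l\<close> improves the bound to \<open>(1 - \<delta>/\<kappa>) \<tau>\<close>. Hence the
  iterate \<open>k + 1\<close> is a stable state at the physical time \<open>k\<close>, dissipating the full amount, and
  consecutive times are at least \<open>(\<delta>/\<kappa>) \<tau>\<close> apart.

  Let \<open>x\<close> be the affine interpolant of these iterates, let \<open>G\<close> be the gradient of the energy without
  the load and \<open>\<gamma> = \<langle>G x - G z, x - z\<rangle>\<close>, which dominates the squared error. Stability of both \<open>x\<close> and
  \<open>z\<close> bounds the growth of \<open>\<gamma>\<close> on the step \<open>k\<close> by \<open>C \<gamma>\<close> plus \<open>2 \<langle>\<xi>\<^sub>k - \<xi>\<^sub>k\<^sub>-\<^sub>1, v\<^sub>k\<rangle>\<close> plus interpolation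
  errors, where \<open>\<xi>\<^sub>k\<close> is the driving force and \<open>v\<^sub>k\<close> the discrete rate. The naive bound of the product
  gives only the order \<open>\<tau>\<^sup>1\<^sup>/\<^sup>2\<close> for the error; but it is nonnegative, at most
  \<open>\<langle>\<xi>\<^sub>k - \<xi>\<^sub>k\<^sub>-\<^sub>1, v\<^sub>k - v\<^sub>k\<^sub>-\<^sub>1\<rangle>\<close>, and the latter, divided by the step size, telescopes up to the variation
  of \<open>l'\<close>. So the contributions add up to a multiple of \<open>\<tau>\<^sup>2\<close>. Everything is carried out with
  increments, so that \<open>\<gamma>\<close> and \<open>z\<close> need not be differentiated.
\<close>

section \<open>Auxiliary results\<close>

lemma real_derivative_line:
  fixes f :: "'a::real_normed_vector \<Rightarrow> real"
  assumes "(f has_derivative blinfun_apply f') (at (y + s *\<^sub>R w))"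
  shows "((\<lambda>s. f (y + s *\<^sub>R w)) has_real_derivative f' w) (at s)"
proof -
  have "((\<lambda>s. f (y + s *\<^sub>R w)) has_derivative (\<lambda>r. f' (r *\<^sub>R w))) (at s)"
    by (rule has_derivative_compose[where f = "\<lambda>s. y + s *\<^sub>R w", OF _ assms])
      (auto intro!: derivative_eq_intros)
  then show ?thesis
    unfolding has_field_derivative_def
    by (rule has_derivative_eq_rhs) (auto simp: blinfun.scaleR_right fun_eq_iff)
qed

lemma real_derivative_line_blinfun:
  fixes g :: "'a::real_normed_vector \<Rightarrow> 'b::real_normed_vector \<Rightarrow>\<^sub>L real"
  assumes "(g has_derivative blinfun_apply g') (at (y + s *\<^sub>R w))"
  shows "((\<lambda>s. g (y + s *\<^sub>R w) v) has_real_derivative g' w v) (at s)"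
proof -
  have "((\<lambda>s. g (y + s *\<^sub>R w)) has_derivative (\<lambda>r. g' (r *\<^sub>R w))) (at s)"
    by (rule has_derivative_compose[where f = "\<lambda>s. y + s *\<^sub>R w", OF _ assms])
      (auto intro!: derivative_eq_intros)
  from bounded_linear.has_derivative[OF blinfun.bounded_linear_left this] show ?thesis
    unfolding has_field_derivative_def
    by (rule has_derivative_eq_rhs) (auto simp: blinfun.scaleR_right blinfun.scaleR_left fun_eq_iff)
qed

text \<open>The mixed second difference of \<open>f\<close> is symmetric in \<open>v\<close> and
  \<open>w\<close>. Two applications of the mean value theorem write it as
  \<open>t * t * H p w v\<close> with \<open>p\<close> within \<open>O(t)\<close> of
  \<open>u\<close>; continuity of \<open>H\<close> at \<open>u\<close> lets \<open>t\<close> tend to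
  0.\<close>

lemma second_derivative_symmetric:
  fixes f :: "'a::real_normed_vector \<Rightarrow> real"
    and G :: "'a \<Rightarrow> 'a \<Rightarrow>\<^sub>L real" and H :: "'a \<Rightarrow> 'a \<Rightarrow>\<^sub>L ('a \<Rightarrow>\<^sub>L real)"
  assumes f: "\<And>u. (f has_derivative G u) (at u)"
    and G: "\<And>u. (G has_derivative H u) (at u)"
    and H: "isCont H u"
  shows "H u v w = H u w v"
proof -
  have mixed: "\<exists>p. norm (p - u) \<le> t * (norm v + norm w) \<and>
      f (u + t *\<^sub>R v + t *\<^sub>R w) - f (u + t *\<^sub>R v) - f (u + t *\<^sub>R w) + f u = t * t * H p w v"
    if t: "0 < t" for t :: real and v w :: 'a
  proof -
    let ?g = "\<lambda>s. f (u + s *\<^sub>R v + t *\<^sub>R w) - f (u + s *\<^sub>R v)"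
    have "\<exists>s. 0 < s \<and> s < t \<and> ?g t - ?g 0 = (t - 0) * (G (u + s *\<^sub>R v + t *\<^sub>R w) v - G (u + s *\<^sub>R v) v)"
    proof (rule MVT2[OF t])
      fix s :: real
      show "(?g has_real_derivative (G (u + s *\<^sub>R v + t *\<^sub>R w) v - G (u + s *\<^sub>R v) v)) (at s)"
        unfolding has_field_derivative_def
        by (rule derivative_eq_intros has_derivative_compose[OF _ f] refl)+
          (auto simp: blinfun.scaleR_right algebra_simps)
    qed
    then obtain s where s: "0 < s" "s < t"
      and g: "?g t - ?g 0 = t * (G (u + s *\<^sub>R v + t *\<^sub>R w) v - G (u + s *\<^sub>R v) v)" by auto
    have "\<exists>r. 0 < r \<and> r < t \<and> G (u + s *\<^sub>R v + t *\<^sub>R w) v - G (u + s *\<^sub>R v + 0 *\<^sub>R w) v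
        = (t - 0) * H (u + s *\<^sub>R v + r *\<^sub>R w) w v"
    proof (rule MVT2[OF t])
      fix r :: real
      show "((\<lambda>r. G (u + s *\<^sub>R v + r *\<^sub>R w) v) has_real_derivative H (u + s *\<^sub>R v + r *\<^sub>R w) w v) (at r)"
        by (rule real_derivative_line_blinfun[OF G])
    qed
    then obtain r where r: "0 < r" "r < t"
      and G': "G (u + s *\<^sub>R v + t *\<^sub>R w) v - G (u + s *\<^sub>R v) v = t * H (u + s *\<^sub>R v + r *\<^sub>R w) w v"
      by auto
    have "norm (u + s *\<^sub>R v + r *\<^sub>R w - u) \<le> norm (s *\<^sub>R v) + norm (r *\<^sub>R w)"
      using norm_triangle_ineq[of "s *\<^sub>R v" "r *\<^sub>R w"] by (simp add: add.assoc)
    also have "\<dots> \<le> t * (norm v + norm w)"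
      using s r by (auto simp: distrib_left intro!: add_mono mult_right_mono)
    finally show ?thesis using g G' by (intro exI[of _ "u + s *\<^sub>R v + r *\<^sub>R w"]) (auto simp: algebra_simps)
  qed
  have lim: "((\<lambda>t. H (P t) a b) \<longlongrightarrow> H u a b) (at_right 0)"
    if P: "\<And>t. 0 < t \<Longrightarrow> norm (P t - u) \<le> t * c" for P a b c
  proof -
    have "((\<lambda>t. t * c) \<longlongrightarrow> 0) (at_right 0)"
      by (auto intro!: tendsto_eq_intros)
    then have "(P \<longlongrightarrow> u) (at_right 0)"
      by (rule Lim_null_comparison[THEN LIM_zero_cancel, rotated])
        (auto simp: eventually_at_filter P)
    from isCont_tendsto_compose[OF H this] show ?thesis
      by (intro tendsto_intros)
  qed
  obtain P where P: "\<And>t. 0 < t \<Longrightarrow> norm (P t - u) \<le> t * (norm v + norm w)"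
    "\<And>t. 0 < t \<Longrightarrow> f (u + t *\<^sub>R v + t *\<^sub>R w) - f (u + t *\<^sub>R v) - f (u + t *\<^sub>R w) + f u = t * t * H (P t) w v"
    using mixed[of _ v w] by metis
  obtain Q where Q: "\<And>t. 0 < t \<Longrightarrow> norm (Q t - u) \<le> t * (norm w + norm v)"
    "\<And>t. 0 < t \<Longrightarrow> f (u + t *\<^sub>R w + t *\<^sub>R v) - f (u + t *\<^sub>R w) - f (u + t *\<^sub>R v) + f u = t * t * H (Q t) v w"
    using mixed[of _ w v] by metis
  have "H (P t) w v = H (Q t) v w" if "0 < t" for t
  proof -
    have "t * t * H (P t) w v = t * t * H (Q t) v w"
      using P(2)[OF that] Q(2)[OF that] by (simp add: algebra_simps)
    then show ?thesis using that by simp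
  qed
  then have "\<forall>\<^sub>F t in at_right 0. H (Q t) v w = H (P t) w v"
    by (auto simp: eventually_at_filter)
  from Lim_transform_eventually[OF lim[OF Q(1)] this] lim[OF P(1)] show ?thesis
    by (rule tendsto_unique[rotated]) auto
qed

section \<open>Integral inequalities and a Gronwall estimate for increments\<close>

text \<open>Sublinearity gives the estimate for tagged Riemann sums, and the bound by the norm
  carries it to the limit. In the applications \<open>q\<close> is the norm, or the dissipation
  minus a frozen force.\<close>

lemma has_integral_sublinear_le:
  fixes f :: "real \<Rightarrow> 'a::real_normed_vector" and q :: "'a \<Rightarrow> real"
  assumes f: "(f has_integral I) {a..b}" and g: "(g has_integral J) {a..b}"
    and le: "\<And>x. x \<in> {a..b} \<Longrightarrow> q (f x) \<le> g x"
    and add: "\<And>x y. q (x + y) \<le> q x + q y"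
    and scale: "\<And>c x. 0 \<le> c \<Longrightarrow> q (c *\<^sub>R x) = c * q x"
    and bound: "\<And>x. q x \<le> K * norm x"
  shows "q I \<le> J"
proof (rule field_le_epsilon)
  fix e :: real assume "0 < e"
  define e' where "e' = e / (\<bar>K\<bar> + 1)"
  have K1: "0 < \<bar>K\<bar> + 1" by linarith
  have e': "0 < e'" "e' * (\<bar>K\<bar> + 1) = e" unfolding e'_def using \<open>0 < e\<close> K1 by simp_all
  obtain d1 where d1: "gauge d1" "\<And>D. D tagged_division_of {a..b} \<Longrightarrow> d1 fine D \<Longrightarrow>
      norm ((\<Sum>(x, k)\<in>D. measure lborel k *\<^sub>R f x) - I) < e'"
    using f[unfolded has_integral_real, rule_format, OF e'(1)] by metis
  obtain d2 where d2: "gauge d2" "\<And>D. D tagged_division_of {a..b} \<Longrightarrow> d2 fine D \<Longrightarrow>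
      norm ((\<Sum>(x, k)\<in>D. measure lborel k *\<^sub>R g x) - J) < e'"
    using g[unfolded has_integral_real, rule_format, OF e'(1)] by metis
  obtain D where D: "D tagged_division_of {a..b}" "(\<lambda>x. d1 x \<inter> d2 x) fine D"
    using fine_division_exists_real[OF gauge_Int[OF d1(1) d2(1)]] by blast
  then have fine: "d1 fine D" "d2 fine D" by (auto simp: fine_Int)
  let ?S = "\<Sum>(x, k)\<in>D. measure lborel k *\<^sub>R f x"
  have q0: "q 0 = 0" using scale[of 0 0] by simp
  have sum: "q (\<Sum>i\<in>N. h i) \<le> (\<Sum>i\<in>N. q (h i))" for N and h :: "real \<times> real set \<Rightarrow> 'a"
  proof (induction N rule: infinite_finite_induct)
    case (insert i N)
    then show ?case using add[of "h i" "sum h N"] by simp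
  qed (simp_all add: q0)
  have "q I \<le> q ?S + q (I - ?S)" using add[of ?S "I - ?S"] by simp
  also have "q (I - ?S) \<le> \<bar>K\<bar> * e'"
  proof -
    have "q (I - ?S) \<le> K * norm (I - ?S)" by (rule bound)
    also have "\<dots> \<le> \<bar>K\<bar> * norm (I - ?S)" by (intro mult_right_mono) auto
    also have "\<dots> \<le> \<bar>K\<bar> * e'"
      using d1(2)[OF D(1) fine(1)] by (intro mult_left_mono) (auto simp: norm_minus_commute)
    finally show ?thesis .
  qed
  also have "q ?S \<le> (\<Sum>(x, k)\<in>D. measure lborel k *\<^sub>R g x)"
  proof -
    have "q ?S \<le> (\<Sum>i\<in>D. q (case i of (x, k) \<Rightarrow> measure lborel k *\<^sub>R f x))" by (rule sum)
    also have "\<dots> \<le> (\<Sum>(x, k)\<in>D. measure lborel k *\<^sub>R g x)"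
    proof (rule sum_mono, clarify)
      fix x k assume "(x, k) \<in> D"
      then have "x \<in> {a..b}" using D(1) by (metis subsetD tagged_division_ofD(2) tagged_division_ofD(3))
      then show "q (measure lborel k *\<^sub>R f x) \<le> measure lborel k *\<^sub>R g x"
        using le by (auto simp: scale intro!: mult_left_mono)
    qed
    finally show ?thesis .
  qed
  also have "(\<Sum>(x, k)\<in>D. measure lborel k *\<^sub>R g x) \<le> J + e'"
    using d2(2)[OF D(1) fine(2)] by (simp add: abs_less_iff)
  finally show "q I \<le> J + e" using e'(2) by (simp add: algebra_simps)
qed

text \<open>On an equidistant grid the \<open>M\<close> terms telescope and carry the step length as
  a factor, so they vanish under refinement.\<close>

lemma gronwall_increments:
  fixes g M :: "real \<Rightarrow> real"
  assumes ab: "a \<le> b" and c: "0 \<le> c" and B: "0 \<le> B"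
    and g0: "\<And>t. t \<in> {a..b} \<Longrightarrow> 0 \<le> g t"
    and M: "mono_on {a..b} M"
    and inc: "\<And>s t. a \<le> s \<Longrightarrow> s \<le> t \<Longrightarrow> t \<le> b \<Longrightarrow>
      g t - g s \<le> (t - s) * (c * g s + B) + (t - s) * (M t - M s)"
  shows "g b \<le> exp (c * (b - a)) * (g a + B * (b - a))"
proof -
  have *: "g b \<le> exp (c * (b - a)) * (g a + B * (b - a) + (b - a) * (M b - M a) * inverse (real (Suc n)))" for n
  proof -
    define d where "d = (b - a) / Suc n"
    have d0: "0 \<le> d" using ab by (simp add: d_def)
    have dn: "d * Suc n = b - a" by (simp add: d_def)
    \<comment> \<open>Discrete Gronwall at the grid points: each factor \<open>1 + c * d\<close> is
      absorbed into \<open>exp (c * d)\<close>.\<close>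
    have "g (a + d * i) \<le> exp (c * (d * i)) * (g a + B * (d * i) + d * (M (a + d * i) - M a))"
      if "i \<le> Suc n" for i
      using that
    proof (induction i)
      case 0
      then show ?case by simp
    next
      case (Suc i)
      let ?s = "a + d * i" and ?t = "a + d * Suc i"
      have "d * Suc i \<le> d * Suc n" using Suc.prems d0 by (intro mult_left_mono) auto
      then have t: "?t \<le> b" using dn by linarith
      have ts: "?t - ?s = d" by (simp add: algebra_simps)
      have s: "a \<le> ?s" "?s \<le> ?t" using d0 by (simp_all add: mult_left_mono)
      have "1 + c * d \<le> exp (c * d)" by simp
      have gs: "0 \<le> g ?s" using g0 s t by auto
      have Ms: "M ?s \<le> M ?t" using M s t by (auto simp: mono_on_def)
      have "g ?t \<le> (1 + c * d) * g ?s + (d * B + d * (M ?t - M ?s))"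
        using inc[OF s t] unfolding ts by (simp add: algebra_simps)
      also have "\<dots> \<le> exp (c * d) * g ?s + exp (c * (d * Suc i)) * (d * B + d * (M ?t - M ?s))"
      proof (rule add_mono)
        show "(1 + c * d) * g ?s \<le> exp (c * d) * g ?s"
          using gs by (intro mult_right_mono) auto
        have "1 \<le> exp (c * (d * Suc i))" using c d0 by simp
        moreover have "0 \<le> d * B + d * (M ?t - M ?s)" using d0 B Ms by simp
        ultimately show "d * B + d * (M ?t - M ?s) \<le> exp (c * (d * Suc i)) * (d * B + d * (M ?t - M ?s))"
          by (metis mult_right_mono mult_1)
      qed
      also have "\<dots> \<le> exp (c * d) * (exp (c * (d * i)) * (g a + B * (d * i) + d * (M ?s - M a)))
          + exp (c * (d * Suc i)) * (d * B + d * (M ?t - M ?s))"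
        using Suc d0 by (intro add_mono mult_left_mono) auto
      also have "\<dots> = exp (c * (d * Suc i)) * (g a + B * (d * Suc i) + d * (M ?t - M a))"
      proof -
        have "exp (c * (d * Suc i)) = exp (c * d) * exp (c * (d * i))"
          by (simp add: exp_add[symmetric] algebra_simps)
        then show ?thesis by (simp only:) (simp add: algebra_simps)
      qed
      finally show ?case .
    qed
    from this[of "Suc n"] show ?thesis unfolding dn by (simp add: d_def divide_inverse algebra_simps)
  qed
  have "(\<lambda>n. exp (c * (b - a)) * (g a + B * (b - a) + (b - a) * (M b - M a) * inverse (real (Suc n))))
      \<longlonglongrightarrow> exp (c * (b - a)) * (g a + B * (b - a) + (b - a) * (M b - M a) * 0)"
    by (intro tendsto_intros LIMSEQ_inverse_real_of_nat)
  from LIMSEQ_le_const[OF this] * show ?thesis by (simp del: mult_cancel_left)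
qed

section \<open>Functions of bounded variation\<close>

text \<open>\<open>V t\<close> is the variation of \<open>h\<close> on \<open>[a, t]\<close>.
  Appending \<open>s\<close> and \<open>t\<close> to any partition of \<open>[a, s]\<close> shows
  that \<open>V\<close> grows from \<open>s\<close> to \<open>t\<close> by at least the norm of the
  increment.\<close>

lemma bounded_pointwise_variation_monotone_control:
  fixes h :: "real \<Rightarrow> 'a::real_normed_vector"
  assumes "bounded_pointwise_variation_on {a..b} h"
  obtains V :: "real \<Rightarrow> real" where "mono_on {a..b} V"
    "\<And>s t. s \<in> {a..b} \<Longrightarrow> t \<in> {a..b} \<Longrightarrow> s \<le> t \<Longrightarrow> norm (h t - h s) \<le> V t - V s"
proof -
  define A where "A t = {\<Sum>i<n. norm (h (p (Suc i)) - h (p i)) | n p. mono_on {..n} p \<and> p ` {..n} \<subseteq> {a..t}}"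
    for t :: real
  define V where "V t = Sup (A t)" for t
  obtain K where K: "\<And>n p. mono_on {..n::nat} p \<Longrightarrow> p ` {..n} \<subseteq> {a..b} \<Longrightarrow>
      (\<Sum>i<n. norm (h (p (Suc i)) - h (p i))) \<le> K"
    using assms unfolding bounded_pointwise_variation_on_def by blast
  have bdd: "bdd_above (A t)" if "t \<le> b" for t
  proof (rule bdd_aboveI)
    fix x assume "x \<in> A t"
    then obtain n p where "x = (\<Sum>i<n. norm (h (p (Suc i)) - h (p i)))" "mono_on {..n} p" "p ` {..n} \<subseteq> {a..t}"
      unfolding A_def by blast
    then show "x \<le> K" using that by (auto intro!: K)
  qed
  have main: "norm (h t - h s) \<le> V t - V s" if st: "a \<le> s" "s \<le> t" "t \<le> b" for s t
  proof -
    have "x \<le> V t - norm (h t - h s)" if xA: "x \<in> A s" for x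
    proof -
      obtain n p where x: "x = (\<Sum>i<n. norm (h (p (Suc i)) - h (p i)))"
        and p: "mono_on {..n} p" "p ` {..n} \<subseteq> {a..s}"
        using xA unfolding A_def by blast
      define p' where "p' i = (if i \<le> n then p i else if i = Suc n then s else t)" for i
      have pn: "\<And>i. i \<le> n \<Longrightarrow> a \<le> p i \<and> p i \<le> s" using p(2) by auto
      have m: "mono_on {..Suc (Suc n)} p'"
      proof (rule mono_onI)
        fix i k assume "i \<in> {..Suc (Suc n)}" "k \<in> {..Suc (Suc n)}" "i \<le> k"
        then show "p' i \<le> p' k"
          using mono_onD[OF p(1), of i k] pn[of i] st by (auto simp: p'_def)
      qed
      have r: "p' ` {..Suc (Suc n)} \<subseteq> {a..t}"
        using pn st by (force simp: p'_def)
      have "(\<Sum>i<Suc (Suc n). norm (h (p' (Suc i)) - h (p' i))) \<in> A t"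
        unfolding A_def using m r by blast
      then have "(\<Sum>i<Suc (Suc n). norm (h (p' (Suc i)) - h (p' i))) \<le> V t"
        unfolding V_def using bdd st by (intro cSup_upper) auto
      moreover have "(\<Sum>i<n. norm (h (p' (Suc i)) - h (p' i))) = x"
        unfolding x by (rule sum.cong) (auto simp: p'_def)
      moreover have "p' (Suc (Suc n)) = t" "p' (Suc n) = s" by (auto simp: p'_def)
      ultimately show ?thesis
        using norm_ge_zero[of "h s - h (p' n)"] unfolding sum.lessThan_Suc by (simp; linarith)
    qed
    moreover have "(\<Sum>i<0. norm (h ((\<lambda>_. a) (Suc i)) - h ((\<lambda>_. a) i))) \<in> A s"
      unfolding A_def using st
      by (intro CollectI exI[of _ 0] exI[of _ "\<lambda>_. a"]) (auto simp: mono_on_def)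
    ultimately have "V s \<le> V t - norm (h t - h s)"
      unfolding V_def[of s] by (intro cSup_least) auto
    then show ?thesis by simp
  qed
  show ?thesis
  proof (rule that)
    show "mono_on {a..b} V"
    proof (rule mono_onI)
      fix s t assume "s \<in> {a..b}" "t \<in> {a..b}" "s \<le> t"
      then show "V s \<le> V t" using main[of s t] norm_ge_zero[of "h t - h s"] by (simp; linarith)
    qed
  qed (use main in auto)
qed

section \<open>Derivatives, optimal Lipschitz constants and symmetric bilinear forms\<close>

lemma has_derivative_fderiv:
  assumes "f differentiable (at x)"
  shows "(f has_derivative fderiv f x) (at x)"
  using assms
  by (metis fderiv_def bounded_linear_Blinfun_apply frechet_derivative_works has_derivative_bounded_linear)

lemma fderiv_eqI:
  assumes "(f has_derivative blinfun_apply f') (at x)"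
  shows "fderiv f x = f'"
  by (metis fderiv_def assms blinfun_apply_inverse frechet_derivative_at)

text \<open>Every Lipschitz constant bounds all difference quotients, hence so does the
  infimum.\<close>

lemma lipschitz_on_lipschitz_const:
  assumes "\<exists>L. L-lipschitz_on S f"
  shows "(lipschitz_const S f)-lipschitz_on S f"
proof (rule lipschitz_onI)
  let ?A = "{L. L-lipschitz_on S f}"
  have ne: "?A \<noteq> {}" using assms by auto
  show "0 \<le> lipschitz_const S f"
    unfolding lipschitz_const_def using ne by (intro cInf_greatest) (auto dest: lipschitz_on_nonneg)
  fix x y assume xy: "x \<in> S" "y \<in> S"
  show "dist (f x) (f y) \<le> lipschitz_const S f * dist x y"
  proof (cases "dist x y = 0")
    case False
    then have "dist (f x) (f y) / dist x y \<le> lipschitz_const S f"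
      unfolding lipschitz_const_def using ne xy
      by (intro cInf_greatest) (auto dest: lipschitz_onD simp: divide_simps)
    then show ?thesis using False by (simp add: divide_simps)
  qed simp
qed

text \<open>Polarization and the parallelogram identity: for unit vectors the squared norms of sum
  and difference add up to 4, so the constant \<open>c\<close> survives unchanged.\<close>

lemma symmetric_bilinear_bound:
  fixes B :: "'a::real_inner \<Rightarrow>\<^sub>L ('a \<Rightarrow>\<^sub>L real)"
  assumes sym: "\<And>v w. B v w = B w v" and quad: "\<And>v. \<bar>B v v\<bar> \<le> c * (norm v)\<^sup>2" 
  shows "\<bar>B v w\<bar> \<le> c * norm v * norm w"
proof (cases "v = 0 \<or> w = 0")
  case True
  then show ?thesis by auto
next
  case False
  have unit: "\<bar>B x y\<bar> \<le> c" if "norm x = 1" "norm y = 1" for x y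
  proof -
    have "4 * B x y = B (x + y) (x + y) - B (x - y) (x - y)"
      by (simp add: blinfun.add_left blinfun.add_right blinfun.diff_left blinfun.diff_right sym[of y x])
    then have "4 * \<bar>B x y\<bar> \<le> c * ((norm (x + y))\<^sup>2 + (norm (x - y))\<^sup>2)"
      using quad[of "x + y"] quad[of "x - y"] by (simp add: distrib_left)
    also have "(norm (x + y))\<^sup>2 + (norm (x - y))\<^sup>2 = 4"
      using that by (simp add: power2_norm_eq_inner inner_simps norm_eq_1 inner_commute)
    finally show ?thesis by simp
  qed
  have "B v w = norm v * norm w * B (sgn v) (sgn w)"
    using False by (simp add: sgn_div_norm blinfun.scaleR_left blinfun.scaleR_right divide_simps)
  then have "\<bar>B v w\<bar> = norm v * norm w * \<bar>B (sgn v) (sgn w)\<bar>" by (simp add: abs_mult)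
  also have "\<dots> \<le> norm v * norm w * c"
    using False unit[of "sgn v" "sgn w"] by (intro mult_left_mono) (auto simp: norm_sgn)
  finally show ?thesis by (simp add: mult_ac)
qed

section \<open>Null sets and increments as integrals of weak derivatives\<close>

lemma AE_lebesgue_on_negligible:
  assumes "AE x in lebesgue_on S. P x" "S \<in> sets lebesgue"
  obtains N where "negligible N" "\<And>x. x \<in> S - N \<Longrightarrow> P x"
proof -
  have "AE x in lebesgue. x \<in> S \<longrightarrow> P x"
    using assms by (subst (asm) AE_restrict_space_iff) auto
  then obtain N where "\<And>x. x \<in> space lebesgue - N \<Longrightarrow> x \<in> S \<longrightarrow> P x" "N \<in> null_sets lebesgue"
    by (rule AE_E3) blast
  then show ?thesis by (intro that[of N]) (auto simp: negligible_iff_null_sets)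
qed

lemma has_integral_increment:
  fixes g f :: "real \<Rightarrow> 'a::banach"
  assumes g: "\<And>t. t \<in> {0..T} \<Longrightarrow> (g has_integral f t - f 0) {0..t}"
    and ab: "0 \<le> a" "a \<le> b" "b \<le> T"
  shows "(g has_integral f b - f a) {a..b}"
proof -
  have ga: "(g has_integral f a - f 0) {0..a}" and gb: "(g has_integral f b - f 0) {0..b}"
    using g ab by auto
  have "g integrable_on {a..b}"
    using has_integral_integrable[OF gb] by (rule integrable_subinterval_real) (use ab in auto)
  then obtain i where i: "(g has_integral i) {a..b}" by (auto simp: integrable_on_def)
  have "f a - f 0 + i = f b - f 0"
    using has_integral_combine[OF ab(1,2) ga i] gb by (rule has_integral_unique)
  then have "i = f b - f a" by (simp add: algebra_simps)
  then show ?thesis using i by simp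
qed

text \<open>\<open>J\<close> preserves the distance of Riemann sums from the candidate integral, so
  convergence pulls back along it. It is applied to the Riesz map.\<close>

lemma has_integral_isometry:
  fixes J :: "'a::real_normed_vector \<Rightarrow> 'b::real_normed_vector"
  assumes J: "bounded_linear J" "\<And>x. norm (J x) = norm x"
    and int: "((\<lambda>t. J (f t)) has_integral J I) {a..b}"
  shows "(f has_integral I) {a..b::real}"
proof -
  interpret bounded_linear J by (rule J)
  have eq: "norm ((\<Sum>(x, k)\<in>D. measure lborel k *\<^sub>R J (f x)) - J I)
      = norm ((\<Sum>(x, k)\<in>D. measure lborel k *\<^sub>R f x) - I)" for D
  proof -
    have "(\<Sum>(x, k)\<in>D. measure lborel k *\<^sub>R J (f x)) - J I
        = J ((\<Sum>(x, k)\<in>D. measure lborel k *\<^sub>R f x) - I)"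
      by (simp add: diff sum scaleR case_prod_unfold)
    then show ?thesis by (simp add: J(2))
  qed
  show ?thesis using int unfolding has_integral_real eq .
qed

lemma norm_blinfun_inner_right: "norm (blinfun_inner_right x) = norm x"
proof (rule antisym)
  show "norm (blinfun_inner_right x) \<le> norm x"
    by (rule norm_blinfun_bound) (auto simp: Cauchy_Schwarz_ineq2)
  show "norm x \<le> norm (blinfun_inner_right x)"
  proof (cases "x = 0")
    case False
    have "norm x * norm x \<le> norm (blinfun_inner_right x) * norm x"
      using norm_blinfun[of "blinfun_inner_right x" x] by (simp add: power2_norm_eq_inner[symmetric] power2_eq_square)
    then show ?thesis using False by simp
  qed simp
qed

text \<open>
  A Hilbert space type of sort \<open>{real_inner, complete_space}\<close> is not of class \<open>banach\<close>, which
  \<open>has_integral_increment\<close> needs; its dual is.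
\<close>

lemma has_integral_increment_inner:
  fixes g f :: "real \<Rightarrow> 'a::{real_inner,complete_space}"
  assumes g: "\<And>t. t \<in> {0..T} \<Longrightarrow> (g has_integral f t - f 0) {0..t}"
    and ab: "0 \<le> a" "a \<le> b" "b \<le> T"
  shows "(g has_integral f b - f a) {a..b}"
proof -
  let ?J = "blinfun_inner_right :: 'a \<Rightarrow> 'a \<Rightarrow>\<^sub>L real"
  have J: "bounded_linear ?J" by (rule bounded_linear_blinfun_inner_right)
  have "((\<lambda>t. ?J (g t)) has_integral ?J (f t) - ?J (f 0)) {0..t}" if "t \<in> {0..T}" for t
    using has_integral_linear[OF g[OF that] J]
    by (simp only: o_def linear_diff[OF bounded_linear.linear[OF J]])
  from has_integral_increment[OF this ab] show ?thesis
    by (intro has_integral_isometry[OF J norm_blinfun_inner_right])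
      (simp only: linear_diff[OF bounded_linear.linear[OF J]])
qed

text \<open>\<open>h\<close> is a representative of \<open>g\<close> of bounded variation and
  \<open>V\<close> its control. Leaving \<open>c\<close> free lets the slopes over adjacent
  intervals be compared with one value of \<open>h\<close>.\<close>

lemma BV_derivative_slopes:
  fixes f g :: "real \<Rightarrow> 'a::banach"
  assumes g: "\<And>t. t \<in> {0..T} \<Longrightarrow> (g has_integral f t - f 0) {0..t}"
    and BV: "BV_on {0..T} g"
  obtains h V where "mono_on {0..T} V"
    "\<And>a' a b b' c. 0 \<le> a' \<Longrightarrow> a' \<le> a \<Longrightarrow> a \<le> b \<Longrightarrow> b \<le> b' \<Longrightarrow> b' \<le> T \<Longrightarrow> c \<in> {a'..b'} \<Longrightarrow>
      norm (f b - f a - (b - a) *\<^sub>R h c) \<le> (b - a) * (V b' - V a')"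
proof -
  obtain h where h: "bounded_pointwise_variation_on {0..T} h" "AE t in lebesgue_on {0..T}. h t = g t"
    using BV unfolding BV_on_def by blast
  obtain V where V: "mono_on {0..T} V"
    "\<And>s t. s \<in> {0..T} \<Longrightarrow> t \<in> {0..T} \<Longrightarrow> s \<le> t \<Longrightarrow> norm (h t - h s) \<le> V t - V s"
    using bounded_pointwise_variation_monotone_control[OF h(1)] by blast
  obtain N where N: "negligible N" "\<And>t. t \<in> {0..T} - N \<Longrightarrow> h t = g t"
    using AE_lebesgue_on_negligible[OF h(2)] by auto
  have "(h has_integral f t - f 0) {0..t}" if "t \<in> {0..T}" for t
    using N(1) _ g[OF that] by (rule has_integral_spike) (use that N(2) in auto)
  note hi = has_integral_increment[OF this]
  show ?thesis
  proof (rule that[OF V(1)])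
    fix a' a b b' c :: real
    assume ab: "0 \<le> a'" "a' \<le> a" "a \<le> b" "b \<le> b'" "b' \<le> T" and c: "c \<in> {a'..b'}"
    have *: "norm (h t - h s) \<le> V b' - V a'" if "s \<in> {a'..b'}" "t \<in> {a'..b'}" "s \<le> t" for s t
      using V(2)[of s t] mono_onD[OF V(1), of a' s] mono_onD[OF V(1), of t b'] that ab by force
    have dev: "norm (h t - h c) \<le> V b' - V a'" if "t \<in> {a..b}" for t
      using *[of t c] *[of c t] that ab c by (cases "t \<le> c") (auto simp: norm_minus_commute)
    have const: "((\<lambda>_. k) has_integral (b - a) *\<^sub>R k) {a..b}" for k :: "'b::real_normed_vector"
      using has_integral_const_real[of k a b] ab by simp
    have "((\<lambda>t. h t - h c) has_integral f b - f a - (b - a) *\<^sub>R h c) {a..b}"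
      using ab by (intro has_integral_diff hi const) auto
    moreover have "((\<lambda>_. V b' - V a') has_integral (b - a) * (V b' - V a')) {a..b}"
      using const[of "V b' - V a'"] by simp
    ultimately show "norm (f b - f a - (b - a) *\<^sub>R h c) \<le> (b - a) * (V b' - V a')"
      by (rule has_integral_sublinear_le[where K = 1]) (auto simp: dev norm_triangle_ineq)
  qed
qed

section \<open>The error of time discretization under local uniform convexity\<close>

text \<open>
  \<open>G\<close> and \<open>H\<close> are the gradient and the Hessian of the part of the energy that does not depend on
  time, and \<open>ell\<close> is the load, with derivative \<open>h\<close> whose variation \<open>V\<close> dominates. The
  differential inclusion for \<open>z\<close> enters only through \<open>z_stable\<close> and the increment form \<open>z_energy\<close>
  of the energy balance, in which \<open>M\<close> is a multiple of a primitive of the norm of the derivative of \<open>z\<close>.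
\<close>

locale convex_evolution =
  fixes G :: "'z::real_inner \<Rightarrow> 'z \<Rightarrow>\<^sub>L real"
    and H :: "'z \<Rightarrow> 'z \<Rightarrow>\<^sub>L ('z \<Rightarrow>\<^sub>L real)"
    and ell h :: "real \<Rightarrow> 'z \<Rightarrow>\<^sub>L real"
    and p :: "'z \<Rightarrow> real"
    and z :: "real \<Rightarrow> 'z"
    and V M :: "real \<Rightarrow> real"
    and T \<kappa> \<Delta> L \<Lambda> C \<rho> :: real
  assumes G_deriv: "\<And>u. (G has_derivative H u) (at u)"
    and H_sym: "\<And>u v w. H u v w = H u w v"
    and H_lip: "\<And>a b v w. a \<in> ball 0 \<rho> \<Longrightarrow> b \<in> ball 0 \<rho> \<Longrightarrow>
      \<bar>H a v w - H b v w\<bar> \<le> C * norm (a - b) * norm v * norm w"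
    and H_conv: "\<And>t u v. t \<in> {0..T} \<Longrightarrow> u \<in> cball (z t) \<Delta> \<Longrightarrow> \<kappa> * (norm v)\<^sup>2 \<le> H u v v"
    and z_ball: "\<And>t. t \<in> {0..T} \<Longrightarrow> cball (z t) \<Delta> \<subseteq> ball 0 \<rho>"
    and p_add: "\<And>x y. p (x + y) \<le> p x + p y"
    and p_scale: "\<And>c x. 0 \<le> c \<Longrightarrow> p (c *\<^sub>R x) = c * p x"
    and ell_lip: "\<And>s t. s \<in> {0..T} \<Longrightarrow> t \<in> {0..T} \<Longrightarrow> norm (ell t - ell s) \<le> \<Lambda> * \<bar>t - s\<bar>"
    and ell_slope: "\<And>a' a b b' c. 0 \<le> a' \<Longrightarrow> a' \<le> a \<Longrightarrow> a \<le> b \<Longrightarrow> b \<le> b' \<Longrightarrow> b' \<le> T \<Longrightarrow> c \<in> {a'..b'} \<Longrightarrow>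
      norm (ell b - ell a - (b - a) *\<^sub>R h c) \<le> (b - a) * (V b' - V a')"
    and V_mono: "mono_on {0..T} V"
    and M_mono: "mono_on {0..T} M"
    and z_lip: "\<And>s t. s \<in> {0..T} \<Longrightarrow> t \<in> {0..T} \<Longrightarrow> norm (z t - z s) \<le> L * \<bar>t - s\<bar>"
    and z_stable: "\<And>t x. t \<in> {0..T} \<Longrightarrow> (ell t - G (z t)) x \<le> p x"
    and z_energy: "\<And>s r t. 0 \<le> s \<Longrightarrow> s \<le> r \<Longrightarrow> r \<le> t \<Longrightarrow> t \<le> T \<Longrightarrow>
      p (z t - z s) \<le> (ell r - G (z r)) (z t - z s) + (t - s) * (M t - M s)"
    and pos: "0 < \<kappa>" "0 < \<Delta>" "0 \<le> L" "0 \<le> \<Lambda>" "0 \<le> C"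
begin

section \<open>The error form between a state and the solution\<close>

lemma G_increment:
  obtains s where "0 < s" "s < 1" "(G (a + d) - G a) x = H (a + s *\<^sub>R d) d x"
proof -
  have "\<exists>s. 0 < s \<and> s < 1 \<and> G (a + 1 *\<^sub>R d) x - G (a + 0 *\<^sub>R d) x = (1 - 0) * H (a + s *\<^sub>R d) d x"
    by (rule MVT2) (auto intro: real_derivative_line_blinfun G_deriv)
  then show ?thesis using that by (auto simp: blinfun.diff_left)
qed

lemma H_lip': 
  assumes "a \<in> ball 0 \<rho>" "b \<in> ball 0 \<rho>" "norm (a - b) \<le> d"
  shows "\<bar>H a v w - H b v w\<bar> \<le> C * d * norm v * norm w"
  using H_lip[OF assms(1,2), of v w] assms(3) pos(5)
  by (elim order_trans) (intro mult_right_mono mult_left_mono; simp)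

definition err :: "real \<Rightarrow> 'z \<Rightarrow> real" where
  "err t x = (G x - G (z t)) (x - z t)"

lemma err_coercive:
  assumes "t \<in> {0..T}" "norm (x - z t) \<le> \<Delta>"
  shows "\<kappa> * (norm (x - z t))\<^sup>2 \<le> err t x"
proof -
  obtain s where s: "0 < s" "s < 1" "err t x = H (z t + s *\<^sub>R (x - z t)) (x - z t) (x - z t)"
    using G_increment[of "z t" "x - z t" "x - z t"] unfolding err_def by auto
  have "norm (s *\<^sub>R (x - z t)) \<le> 1 * norm (x - z t)"
    unfolding norm_scaleR using s by (intro mult_right_mono) auto
  then have "z t + s *\<^sub>R (x - z t) \<in> cball (z t) \<Delta>"
    using assms(2) by (simp add: dist_norm)
  from H_conv[OF assms(1) this] show ?thesis using s(3) by simp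
qed

lemma err_nonneg:
  assumes "t \<in> {0..T}" "norm (x - z t) \<le> \<Delta>"
  shows "0 \<le> err t x"
  using err_coercive[OF assms] pos(1) by (meson order_trans mult_nonneg_nonneg less_imp_le zero_le_power2)

text \<open>The two products would cancel for a constant symmetric Hessian. One mean value argument
  with a common parameter \<open>r\<close> keeps both evaluation points within \<open>D\<close> of
  each other, so only the Lipschitz bound of \<open>H\<close> is paid.\<close>

lemma err_increment_antisymmetric:
  assumes "s \<in> {0..T}" "t \<in> {0..T}" "norm (x - z s) \<le> \<Delta>" "norm (y - z t) \<le> \<Delta>"
    and "norm (z t - z s) \<le> D" "norm (y - x) \<le> D"
  shows "(G y - G (z t)) (x - z s) - (G x - G (z s)) (y - z t)
      \<le> C * D * norm (x - z s) * norm (y - z t)"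
proof -
  let ?e = "x - z s" and ?f = "y - z t"
  let ?g = "\<lambda>r. G (z t + r *\<^sub>R ?f) ?e - G (z s + r *\<^sub>R ?e) ?f"
  have "\<exists>r. 0 < r \<and> r < 1 \<and> ?g 1 - ?g 0 = (1 - 0) * (H (z t + r *\<^sub>R ?f) ?f ?e - H (z s + r *\<^sub>R ?e) ?e ?f)"
    by (rule MVT2) (auto intro!: DERIV_diff real_derivative_line_blinfun G_deriv)
  then obtain r where r: "0 < r" "r < 1"
    and g: "?g 1 - ?g 0 = H (z t + r *\<^sub>R ?f) ?e ?f - H (z s + r *\<^sub>R ?e) ?e ?f"
    by (auto simp: H_sym[of _ ?f ?e])
  have in_ball: "z t + r *\<^sub>R d \<in> ball 0 \<rho>" if "t \<in> {0..T}" "norm d \<le> \<Delta>" for t d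
  proof -
    have "norm (r *\<^sub>R d) \<le> 1 * norm d" unfolding norm_scaleR using r by (intro mult_right_mono) auto
    then have "z t + r *\<^sub>R d \<in> cball (z t) \<Delta>" using that(2) by (simp add: dist_norm)
    then show ?thesis using z_ball[OF that(1)] by blast
  qed
  have "z t + r *\<^sub>R ?f - (z s + r *\<^sub>R ?e) = (1 - r) *\<^sub>R (z t - z s) + r *\<^sub>R (y - x)"
    by (simp add: algebra_simps)
  then have "norm (z t + r *\<^sub>R ?f - (z s + r *\<^sub>R ?e)) \<le> (1 - r) * norm (z t - z s) + r * norm (y - x)"
    using r by (metis (no_types, opaque_lifting) norm_triangle_ineq norm_scaleR abs_of_pos diff_gt_0_iff_gt)
  also have "\<dots> \<le> (1 - r) * D + r * D"
    using assms(5,6) r by (intro add_mono mult_left_mono) auto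
  finally have "norm (z t + r *\<^sub>R ?f - (z s + r *\<^sub>R ?e)) \<le> D" by (simp add: algebra_simps)
  from H_lip'[OF in_ball[OF assms(2,4)] in_ball[OF assms(1,3)] this, of ?e ?f] g
  show ?thesis by (simp add: blinfun.diff_left)
qed

section \<open>The error over one time step\<close>

text \<open>The force along the interpolated state deviates from the interpolated force only by
  curvature: the load through the variation of its slope, the gradient through the Lipschitz
  Hessian.\<close>

lemma force_interpolation:
  assumes ab: "0 \<le> a" "a < b" "b \<le> T" and t: "t \<in> {a..b}"
    and w: "norm (y - x) \<le> b - a" and near: "norm (x - z a) + (b - a) \<le> \<Delta>"
    and \<theta>: "\<theta> = (t - a) / (b - a)"
  shows "\<bar>(ell t - G (x + \<theta> *\<^sub>R (y - x))) u - ((1 - \<theta>) * (ell a - G x) u + \<theta> * (ell b - G y) u)\<bar>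
    \<le> (2 * (V b - V a) * (b - a) + C * (b - a)\<^sup>2) * norm u"
proof -
  let ?w = "y - x"
  have \<theta>01: "0 \<le> \<theta>" "\<theta> \<le> 1" and \<theta>ab: "\<theta> * (b - a) = t - a"
    using ab t by (auto simp: \<theta>)
  have V: "0 \<le> V b - V a" using mono_onD[OF V_mono, of a b] ab by simp
  \<comment> \<open>Deviations of the load from its tangent of slope \<open>h a\<close>; the tangent
    parts cancel in \<open>m1 - \<theta> *\<^sub>R m2\<close> because
    \<open>\<theta> * (b - a) = t - a\<close>.\<close>
  define m1 where "m1 = ell t - ell a - (t - a) *\<^sub>R h a"
  define m2 where "m2 = ell b - ell a - (b - a) *\<^sub>R h a"
  have m1: "norm m1 \<le> (t - a) * (V b - V a)"
    unfolding m1_def using ab t by (intro ell_slope) auto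
  have m2: "norm m2 \<le> (b - a) * (V b - V a)"
    unfolding m2_def using ab t by (intro ell_slope) auto
  have "norm (m1 - \<theta> *\<^sub>R m2) \<le> norm m1 + \<theta> * norm m2"
    using norm_triangle_ineq4[of m1 "\<theta> *\<^sub>R m2"] \<theta>01 by simp
  also have "\<dots> \<le> (t - a) * (V b - V a) + \<theta> * ((b - a) * (V b - V a))"
    using m1 m2 \<theta>01 by (intro add_mono mult_left_mono) auto
  also have "\<dots> = 2 * ((t - a) * (V b - V a))"
    using \<theta>ab by (metis mult.assoc mult_2)
  also have "\<dots> \<le> 2 * ((b - a) * (V b - V a))"
    using t V by (intro mult_left_mono mult_right_mono) auto
  finally have "norm (m1 - \<theta> *\<^sub>R m2) \<le> 2 * (V b - V a) * (b - a)" by (simp add: mult_ac)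
  then have ell: "\<bar>(m1 - \<theta> *\<^sub>R m2) u\<bar> \<le> 2 * (V b - V a) * (b - a) * norm u"
    using order_trans[OF norm_blinfun[of "m1 - \<theta> *\<^sub>R m2" u] mult_right_mono[OF _ norm_ge_zero]]
    by simp
  obtain s where s: "0 < s" "s < 1" "(G (x + \<theta> *\<^sub>R ?w) - G x) u = H (x + s *\<^sub>R (\<theta> *\<^sub>R ?w)) (\<theta> *\<^sub>R ?w) u"
    by (rule G_increment)
  obtain r where r: "0 < r" "r < 1" "(G (x + ?w) - G x) u = H (x + r *\<^sub>R ?w) ?w u"
    by (rule G_increment)
  have in_ball: "x + q *\<^sub>R ?w \<in> ball 0 \<rho>" if "0 \<le> q" "q \<le> 1" for q
  proof -
    have "norm (x + q *\<^sub>R ?w - z a) \<le> norm (x - z a) + norm (q *\<^sub>R ?w)"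
      using norm_triangle_ineq[of "x - z a" "q *\<^sub>R ?w"] by (simp add: algebra_simps)
    also have "norm (q *\<^sub>R ?w) \<le> 1 * norm ?w" unfolding norm_scaleR using that by (intro mult_right_mono) auto
    finally have "x + q *\<^sub>R ?w \<in> cball (z a) \<Delta>"
      using w near by (auto simp: dist_norm norm_minus_commute)
    then show ?thesis using z_ball[of a] ab by auto
  qed
  have s\<theta>: "0 \<le> s * \<theta>" "s * \<theta> \<le> 1"
    using s \<theta>01 by (auto intro: mult_le_one)
  have "norm (x + (s * \<theta>) *\<^sub>R ?w - (x + r *\<^sub>R ?w)) = \<bar>s * \<theta> - r\<bar> * norm ?w"
    by (metis add_diff_cancel_left norm_scaleR scaleR_left_diff_distrib)
  also have "\<dots> \<le> 1 * norm ?w" using s\<theta> r by (intro mult_right_mono) auto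
  finally have d: "norm (x + (s * \<theta>) *\<^sub>R ?w - (x + r *\<^sub>R ?w)) \<le> b - a" using w by simp
  have "\<bar>H (x + (s * \<theta>) *\<^sub>R ?w) ?w u - H (x + r *\<^sub>R ?w) ?w u\<bar> \<le> C * (b - a) * norm ?w * norm u"
    using s\<theta> r d by (intro H_lip' in_ball) auto
  also have "\<dots> \<le> C * (b - a) * (b - a) * norm u"
    using w pos ab by (intro mult_right_mono mult_left_mono) auto
  finally have H: "\<bar>H (x + (s * \<theta>) *\<^sub>R ?w) ?w u - H (x + r *\<^sub>R ?w) ?w u\<bar> \<le> C * (b - a)\<^sup>2 * norm u"
    by (simp add: power2_eq_square mult_ac)
  have "\<bar>\<theta> * (H (x + (s * \<theta>) *\<^sub>R ?w) ?w u - H (x + r *\<^sub>R ?w) ?w u)\<bar>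
      \<le> 1 * \<bar>H (x + (s * \<theta>) *\<^sub>R ?w) ?w u - H (x + r *\<^sub>R ?w) ?w u\<bar>"
    unfolding abs_mult using \<theta>01 by (intro mult_right_mono) auto
  with H have H': "\<bar>\<theta> * (H (x + (s * \<theta>) *\<^sub>R ?w) ?w u - H (x + r *\<^sub>R ?w) ?w u)\<bar> \<le> C * (b - a)\<^sup>2 * norm u"
    by simp
  have G1: "G (x + \<theta> *\<^sub>R ?w) u = G x u + \<theta> * H (x + (s * \<theta>) *\<^sub>R ?w) ?w u"
    using s(3) by (simp add: blinfun.diff_left blinfun.scaleR_right blinfun.scaleR_left)
  have G2: "G y u = G x u + H (x + r *\<^sub>R ?w) ?w u"
    using r(3) by (simp add: blinfun.diff_left)
  have "(ell t - G (x + \<theta> *\<^sub>R ?w)) u - ((1 - \<theta>) * (ell a - G x) u + \<theta> * (ell b - G y) u)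
      = (m1 - \<theta> *\<^sub>R m2) u - \<theta> * (H (x + (s * \<theta>) *\<^sub>R ?w) ?w u - H (x + r *\<^sub>R ?w) ?w u)"
  proof -
    have m: "m1 - \<theta> *\<^sub>R m2 = ell t - ell a - \<theta> *\<^sub>R (ell b - ell a)"
      unfolding m1_def m2_def by (simp add: scaleR_right_diff_distrib \<theta>ab)
    show ?thesis
      unfolding m blinfun.diff_left blinfun.scaleR_left G1 G2
      by (simp only: real_scaleR_def) argo
  qed
  then show ?thesis using ell H' unfolding distrib_right by linarith
qed

text \<open>On \<open>[s, t]\<close> inside \<open>[a, b]\<close> the growth of the error form
  splits into force differences tested with the discrete rate, force differences tested with the
  increment of \<open>z\<close>, and an antisymmetric remainder. Stability of \<open>z\<close>
  controls the first part and the energy balance of \<open>z\<close> the second; the third is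
  bounded by the error form and terms that vanish under refinement.\<close>

lemma step_error:
  assumes ab: "0 \<le> a" "a < b" "b \<le> T"
    and w: "norm (y - x) \<le> b - a"
    and near: "norm (x - z a) + (1 + L) * (b - a) \<le> \<Delta>"
    and sa: "\<And>v. (ell a - G x) v \<le> p v"
    and sb: "\<And>v. (ell b - G y) v \<le> p v"
    and eb: "p (y - x) \<le> (ell b - G y) (y - x)"
  shows "err b y \<le> exp (C * (1 + L) / \<kappa> * (b - a)) *
    (err a x + (2 * ((ell b - G y) (y - x) - (ell a - G x) (y - x))
       + 2 * (1 + L) * (2 * (V b - V a) * (b - a) + C * (b - a)\<^sup>2) * (b - a)))"
proof -
  define v where "v = (1 / (b - a)) *\<^sub>R (y - x)"
  define E where "E = 2 * (V b - V a) * (b - a) + C * (b - a)\<^sup>2"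
  define X where "X t = x + ((t - a) / (b - a)) *\<^sub>R (y - x)" for t
  define \<xi> where "\<xi> t = ell t - G (X t)" for t
  define \<zeta> where "\<zeta> t = ell t - G (z t)" for t
  have ba: "0 < b - a" using ab by simp
  have V: "0 \<le> V b - V a" using mono_onD[OF V_mono, of a b] ab by simp
  have E0: "0 \<le> E" using V ba pos by (simp add: E_def)
  have Xa: "X a = x" and Xb: "X b = y" using ba by (simp_all add: X_def)
  have v1: "norm v \<le> 1" using w ba by (simp add: v_def divide_simps)
  have yx: "y - x = (b - a) *\<^sub>R v" using ba by (simp add: v_def)
  have Xdiff: "X t - X s = (t - s) *\<^sub>R v" for s t
    by (simp add: X_def v_def algebra_simps diff_divide_distrib)
  have pv: "p (y - x) = (b - a) * p v" unfolding yx using ba by (intro p_scale) auto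
  have "(b - a) * p v \<le> (b - a) * (ell b - G y) v"
    using eb unfolding pv unfolding yx by (simp add: blinfun.scaleR_right)
  then have eb': "p v \<le> (ell b - G y) v" using ba by simp
  \<comment> \<open>The product of force increment and rate. It is nonnegative: on \<open>v\<close>
    the force reaches the dissipation at \<open>b\<close> and does not exceed it at
    \<open>a\<close>.\<close>
  define P where "P = (ell b - G y) v - (ell a - G x) v"
  have P0: "0 \<le> P" using sa[of v] eb' by (simp add: P_def)
  have near': "norm (x - z a) + (b - a) \<le> \<Delta>"
    using near mult_nonneg_nonneg[OF pos(3) less_imp_le[OF ba]] by (simp add: distrib_right)
  have interp: "\<bar>\<xi> t u - ((1 - (t - a) / (b - a)) * (ell a - G x) u + (t - a) / (b - a) * (ell b - G y) u)\<bar> \<le> E * norm u"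
    if "t \<in> {a..b}" for t u
    unfolding \<xi>_def X_def E_def using ab that w near' by (intro force_interpolation) auto
  have upper: "\<xi> t u \<le> p u + E * norm u" if t: "t \<in> {a..b}" for t u
  proof -
    define q where "q = (t - a) / (b - a)"
    have q: "0 \<le> q" "q \<le> 1" using t ba by (auto simp: q_def)
    have "(1 - q) * (ell a - G x) u + q * (ell b - G y) u \<le> (1 - q) * p u + q * p u"
      using q sa sb by (intro add_mono mult_left_mono) auto
    also have "\<dots> = p u" by (simp add: algebra_simps)
    finally show ?thesis using interp[OF t, of u] unfolding q_def by linarith
  qed
  have lower: "p v - P - E \<le> \<xi> t v" if t: "t \<in> {a..b}" for t
  proof -
    define q where "q = (t - a) / (b - a)"
    have q: "0 \<le> q" "q \<le> 1" using t ba by (auto simp: q_def)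
    have "(1 - q) * (ell a - G x) v + q * (ell b - G y) v = (ell b - G y) v - (1 - q) * P"
      by (simp add: P_def algebra_simps)
    moreover have "(1 - q) * P \<le> 1 * P" using q P0 by (intro mult_right_mono) auto
    moreover have "E * norm v \<le> E * 1" using v1 E0 by (intro mult_left_mono)
    ultimately show ?thesis using interp[OF t, of v] eb' unfolding q_def by linarith
  qed
  have e_le: "norm (X t - z t) \<le> norm (X s - z s) + (1 + L) * (t - s)" if "a \<le> s" "s \<le> t" "t \<le> b" for s t
  proof -
    have "X t - z t = (X s - z s) + (t - s) *\<^sub>R v - (z t - z s)"
      by (simp add: Xdiff[symmetric])
    then have "norm (X t - z t) \<le> norm (X s - z s) + norm ((t - s) *\<^sub>R v) + norm (z t - z s)"
      by (metis (no_types, lifting) norm_triangle_ineq4 norm_triangle_ineq add_right_mono order_trans)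
    moreover have "norm ((t - s) *\<^sub>R v) \<le> (t - s) * 1"
      unfolding norm_scaleR using that v1 by (intro mult_mono) auto
    moreover have "norm (z t - z s) \<le> L * (t - s)"
      using z_lip[of s t] that ab by auto
    ultimately show ?thesis by (simp add: algebra_simps)
  qed
  have e_near: "norm (X t - z t) \<le> \<Delta>" if t: "t \<in> {a..b}" for t
  proof -
    have "(1 + L) * (t - a) \<le> (1 + L) * (b - a)" using t pos by (intro mult_left_mono) auto
    then show ?thesis using e_le[of a t] t near by (simp add: Xa)
  qed
  define B where "B = 2 * P + 2 * (1 + L) * E"
  \<comment> \<open>\<open>2 * M\<close> stems from the energy balance of \<open>z\<close>, used at
    both ends of \<open>[s, t]\<close>; the linear term absorbs the square of \<open>t - s\<close>
    left by the antisymmetric remainder.\<close>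
  define N where "N t = 2 * M t + C * (1 + L)\<^sup>2 * \<Delta> * t" for t
  have "err b (X b) \<le> exp (C * (1 + L) / \<kappa> * (b - a)) * (err a (X a) + B * (b - a))"
  proof (rule gronwall_increments[where M = N and g = "\<lambda>t. err t (X t)"])
    show "0 \<le> C * (1 + L) / \<kappa>" using pos by simp
    show "0 \<le> B" using P0 E0 pos by (simp add: B_def)
    show "0 \<le> err t (X t)" if "t \<in> {a..b}" for t
      using err_nonneg e_near[OF that] that ab by simp
    show "mono_on {a..b} N"
      unfolding N_def
      using M_mono ab pos by (intro mono_onI add_mono mult_left_mono) (auto simp: mono_on_def)
    show "err t (X t) - err s (X s) \<le> (t - s) * (C * (1 + L) / \<kappa> * err s (X s) + B) + (t - s) * (N t - N s)"
      if st: "a \<le> s" "s \<le> t" "t \<le> b" for s t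
    proof -
      have sT: "s \<in> {0..T}" and tT: "t \<in> {0..T}" and sab: "s \<in> {a..b}" and tab: "t \<in> {a..b}"
        using st ab by auto
      define d where "d = z t - z s"
      define D where "D = (1 + L) * (t - s)"
      have ts: "0 \<le> t - s" using st by simp
      have dn: "norm d \<le> L * (t - s)" using z_lip[OF sT tT] st by (simp add: d_def)
      have vn: "norm ((t - s) *\<^sub>R v) \<le> t - s"
        using v1 ts by (simp add: mult_left_le)
      have LD: "L * (t - s) \<le> D" "t - s \<le> D"
        using ts mult_nonneg_nonneg[OF pos(3) ts] unfolding D_def by (simp_all add: distrib_right)
      \<comment> \<open>Symmetrized product rule: the increment of the error is tested with the sum
        of the force differences at both ends, and the mismatch is the antisymmetric
        expression.\<close>
      have expand: "err t (X t) - err s (X s)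
        = (t - s) * (\<zeta> t v + \<zeta> s v - \<xi> t v - \<xi> s v) + (\<xi> t d + \<xi> s d - \<zeta> t d - \<zeta> s d)
          + ((G (X t) - G (z t)) (X s - z s) - (G (X s) - G (z s)) (X t - z t))"
      proof -
        have Xt: "X t = X s + (t - s) *\<^sub>R v" using Xdiff[of t s] by (simp add: algebra_simps)
        have zt: "z t = z s + d" by (simp add: d_def)
        have eta: "\<zeta> r u - \<xi> r u = G (X r) u - G (z r) u" for r u
          by (simp add: \<zeta>_def \<xi>_def blinfun.diff_left)
        have 1: "X t - z t = (X s - z s) + (t - s) *\<^sub>R v - d" unfolding Xt zt by simp
        have "err t (X t) - err s (X s) = (G (X t) - G (z t)) ((t - s) *\<^sub>R v - d) + (G (X s) - G (z s)) ((t - s) *\<^sub>R v - d)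
          + ((G (X t) - G (z t)) (X s - z s) - (G (X s) - G (z s)) (X t - z t))"
          unfolding err_def 1 by (simp add: blinfun.add_right blinfun.diff_right)
        also have "(G (X t) - G (z t)) ((t - s) *\<^sub>R v - d) + (G (X s) - G (z s)) ((t - s) *\<^sub>R v - d)
          = (t - s) * (\<zeta> t v + \<zeta> s v - \<xi> t v - \<xi> s v) + (\<xi> t d + \<xi> s d - \<zeta> t d - \<zeta> s d)"
          using eta[of t v] eta[of s v] eta[of t d] eta[of s d]
          unfolding blinfun.diff_left blinfun.diff_right blinfun.scaleR_right
          by (simp add: \<zeta>_def \<xi>_def blinfun.diff_left algebra_simps)
        finally show ?thesis .
      qed
      have "\<zeta> t v + \<zeta> s v - \<xi> t v - \<xi> s v \<le> 2 * (P + E)"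
        using z_stable[OF tT, of v] z_stable[OF sT, of v] lower[OF tab] lower[OF sab]
        unfolding \<zeta>_def by argo
      then have 1: "(t - s) * (\<zeta> t v + \<zeta> s v - \<xi> t v - \<xi> s v) \<le> (t - s) * (2 * (P + E))"
        using ts by (rule mult_left_mono)
      have "E * norm d \<le> E * (L * (t - s))" using dn E0 by (rule mult_left_mono)
      then have 2: "\<xi> t d + \<xi> s d - \<zeta> t d - \<zeta> s d \<le> 2 * (E * (L * (t - s))) + 2 * ((t - s) * (M t - M s))"
        using upper[OF tab, of d] upper[OF sab, of d] z_energy[of s s t] z_energy[of s t t] st ab
        unfolding \<zeta>_def d_def by simp
      have "(G (X t) - G (z t)) (X s - z s) - (G (X s) - G (z s)) (X t - z t)
          \<le> C * D * norm (X s - z s) * norm (X t - z t)"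
        using dn vn LD e_near[OF sab] e_near[OF tab]
        by (intro err_increment_antisymmetric sT tT) (auto simp: Xdiff d_def)
      also have "\<dots> \<le> C * D * norm (X s - z s) * (norm (X s - z s) + D)"
        using e_le[OF st] pos ts unfolding D_def by (intro mult_left_mono) auto
      also have "\<dots> = C * D * (norm (X s - z s))\<^sup>2 + C * D\<^sup>2 * norm (X s - z s)"
        by (simp add: power2_eq_square algebra_simps)
      also have "\<dots> \<le> C * D * (err s (X s) / \<kappa>) + C * D\<^sup>2 * \<Delta>"
      proof (intro add_mono mult_left_mono)
        show "(norm (X s - z s))\<^sup>2 \<le> err s (X s) / \<kappa>"
          using err_coercive[OF sT e_near[OF sab]] pos(1) by (simp add: field_simps)
        show "0 \<le> C * D" "0 \<le> C * D\<^sup>2" using pos ts LD(2) by simp_all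
      qed (rule e_near[OF sab])
      finally have 3: "(G (X t) - G (z t)) (X s - z s) - (G (X s) - G (z s)) (X t - z t)
          \<le> C * D * (err s (X s) / \<kappa>) + C * D\<^sup>2 * \<Delta>" .
      have "err t (X t) - err s (X s) \<le> (t - s) * (2 * (P + E)) + (2 * (E * (L * (t - s))) + 2 * ((t - s) * (M t - M s)))
          + (C * D * (err s (X s) / \<kappa>) + C * D\<^sup>2 * \<Delta>)"
        unfolding expand using 1 2 3 by linarith
      also have "\<dots> = (t - s) * (C * (1 + L) / \<kappa> * err s (X s) + B) + (t - s) * (N t - N s)"
        by (simp add: B_def N_def D_def power2_eq_square algebra_simps add_divide_distrib diff_divide_distrib)
      finally show ?thesis .
    qed
  qed (use ba in simp)
  also have "B * (b - a) = 2 * ((ell b - G y) (y - x) - (ell a - G x) (y - x)) + 2 * (1 + L) * E * (b - a)"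
    unfolding B_def P_def yx blinfun.scaleR_right by (simp add: algebra_simps)
  finally show ?thesis unfolding Xa Xb E_def .
qed

section \<open>Discrete evolutions: times, rates and load slopes\<close>

text \<open>The properties of the incremental scheme that the estimate uses. Closeness to
  \<open>z\<close> is demanded only before the last state, with a reserve for one more step, so that
  it can be supplied inductively.\<close>

definition discrete_evolution :: "real \<Rightarrow> nat \<Rightarrow> (nat \<Rightarrow> 'z) \<Rightarrow> (nat \<Rightarrow> real) \<Rightarrow> bool" where
  "discrete_evolution \<tau> n x r \<longleftrightarrow>
     0 < \<tau> \<and> x 0 = z 0 \<and> r 0 = 0 \<and> r n \<le> T \<and>
     (\<forall>i\<le>n. \<forall>v. (ell (r i) - G (x i)) v \<le> p v) \<and>
     (\<forall>i<n. r i < r (Suc i) \<and> r (Suc i) \<le> r i + \<tau> \<and>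
        norm (x (Suc i) - x i) \<le> r (Suc i) - r i \<and>
        p (x (Suc i) - x i) \<le> (ell (r (Suc i)) - G (x (Suc i))) (x (Suc i) - x i) \<and>
        norm (x i - z (r i)) + (1 + L) * \<tau> \<le> \<Delta>)"

context
  fixes \<tau> n x r
  assumes ev: "discrete_evolution \<tau> n x r"
begin

lemma discrete_start: "0 < \<tau>" "x 0 = z 0" "r 0 = 0"
  using ev by (auto simp: discrete_evolution_def)

lemma discrete_stable: "i \<le> n \<Longrightarrow> (ell (r i) - G (x i)) v \<le> p v"
  using ev by (auto simp: discrete_evolution_def)

lemma discrete_step:
  assumes "i < n"
  shows "r i < r (Suc i)" "r (Suc i) - r i \<le> \<tau>"
    "norm (x (Suc i) - x i) \<le> r (Suc i) - r i"
    "p (x (Suc i) - x i) \<le> (ell (r (Suc i)) - G (x (Suc i))) (x (Suc i) - x i)"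
    "norm (x i - z (r i)) + (1 + L) * \<tau> \<le> \<Delta>"
  using ev assms by (auto simp: discrete_evolution_def algebra_simps)

lemma discrete_time_mono: "i \<le> k \<Longrightarrow> k \<le> n \<Longrightarrow> r i \<le> r k"
proof (induction k rule: dec_induct)
  case (step k)
  then show ?case using discrete_step(1)[of k] by simp
qed simp

lemma discrete_time_range: "i \<le> n \<Longrightarrow> r i \<in> {0..T}"
  using discrete_time_mono[of 0 i] discrete_time_mono[of i n] ev discrete_start
  by (auto simp: discrete_evolution_def)

lemma discrete_control_mono: "i \<le> k \<Longrightarrow> k \<le> n \<Longrightarrow> V (r i) \<le> V (r k)"
  using discrete_time_mono discrete_time_range by (intro mono_onD[OF V_mono]) auto

lemma discrete_segment:
  assumes i: "i < n" and s: "0 \<le> s" "s \<le> 1"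
  shows "x i + s *\<^sub>R (x (Suc i) - x i) \<in> cball (z (r i)) \<Delta>"
proof -
  have "norm (x i + s *\<^sub>R (x (Suc i) - x i) - z (r i)) \<le> norm (x i - z (r i)) + norm (s *\<^sub>R (x (Suc i) - x i))"
    using norm_triangle_ineq[of "x i - z (r i)" "s *\<^sub>R (x (Suc i) - x i)"] by (simp add: algebra_simps)
  also have "norm (s *\<^sub>R (x (Suc i) - x i)) \<le> 1 * norm (x (Suc i) - x i)"
    unfolding norm_scaleR using s by (intro mult_right_mono) auto
  also have "\<dots> \<le> (1 + L) * \<tau>"
    using discrete_step(1-3)[OF i] pos(3) by (simp add: distrib_right add_increasing2)
  finally show ?thesis using discrete_step(5)[OF i] by (simp add: dist_norm norm_minus_commute)
qed

text \<open>Since \<open>0 - 1 = 0\<close> on the naturals, \<open>rate 0 = 0\<close>: the evolution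
  starts at rest and the first step telescopes like all others.\<close>

definition rate :: "nat \<Rightarrow> 'z" where
  "rate i = (1 / (r i - r (i - 1))) *\<^sub>R (x i - x (i - 1))"

definition slope :: "nat \<Rightarrow> 'z \<Rightarrow>\<^sub>L real" where
  "slope i = (1 / (r i - r (i - 1))) *\<^sub>R (ell (r i) - ell (r (i - 1)))"

lemma rate_0: "rate 0 = 0"
  by (simp add: rate_def)

lemma rate_Suc: "i < n \<Longrightarrow> x (Suc i) - x i = (r (Suc i) - r i) *\<^sub>R rate (Suc i)"
  using discrete_step(1)[of i] by (simp add: rate_def)

lemma norm_rate_le: "i \<le> n \<Longrightarrow> norm (rate i) \<le> 1"
  using discrete_step(1,3)[of "i - 1"] by (cases i) (auto simp: rate_def divide_simps)

lemma rate_energy: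
  assumes "i < n"
  shows "p (rate (Suc i)) \<le> (ell (r (Suc i)) - G (x (Suc i))) (rate (Suc i))"
proof -
  have h: "0 < r (Suc i) - r i" using discrete_step(1)[OF assms] by simp
  have "(r (Suc i) - r i) * p (rate (Suc i)) \<le> (r (Suc i) - r i) * (ell (r (Suc i)) - G (x (Suc i))) (rate (Suc i))"
    using discrete_step(4)[OF assms] h
    by (simp add: rate_Suc[OF assms] p_scale blinfun.scaleR_right)
  then show ?thesis using h by simp
qed

lemma norm_slope_le:
  assumes "i \<le> n" shows "norm (slope i) \<le> \<Lambda>"
proof (cases i)
  case 0
  then show ?thesis using pos by (simp add: slope_def)
next
  case (Suc m)
  then have m: "m < n" using assms by simp
  then show ?thesis
    using discrete_step(1)[OF m] ell_lip[of "r m" "r i"] discrete_time_range[of m] discrete_time_range[of i] Suc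
    by (simp add: slope_def divide_simps)
qed

lemma slope_near:
  assumes m: "m < n" and c: "c \<in> {r m..r (Suc m)}"
  shows "norm (slope (Suc m) - h c) \<le> V (r (Suc m)) - V (r m)"
proof -
  have d: "0 < r (Suc m) - r m" using discrete_step(1)[OF m] by simp
  have "slope (Suc m) - h c =
      (1 / (r (Suc m) - r m)) *\<^sub>R (ell (r (Suc m)) - ell (r m) - (r (Suc m) - r m) *\<^sub>R h c)"
    using d by (simp add: slope_def scaleR_right_diff_distrib)
  moreover have "norm (ell (r (Suc m)) - ell (r m) - (r (Suc m) - r m) *\<^sub>R h c)
      \<le> (r (Suc m) - r m) * (V (r (Suc m)) - V (r m))"
    using discrete_time_range[of m] discrete_time_range[of "Suc m"] m d c by (intro ell_slope) auto
  ultimately show ?thesis using d by (simp add: divide_simps mult.commute)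
qed

text \<open>The slopes over two adjacent intervals are both compared with \<open>h\<close> at the
  common node \<open>r m\<close>, which costs the variation over their union. For
  \<open>m = 0\<close> the rate vanishes.\<close>

lemma slope_variation:
  assumes m: "m < n"
  shows "slope m (rate m) - slope (Suc m) (rate m) \<le> V (r (Suc m)) - V (r (m - 1))"
proof (cases m)
  case 0
  then show ?thesis using discrete_control_mono[of 0 "Suc 0"] m by (simp add: rate_0)
next
  case (Suc k)
  have k: "k < n" using m Suc by simp
  have "norm (slope m - slope (Suc m)) \<le> norm (slope m - h (r m)) + norm (slope (Suc m) - h (r m))"
    using norm_triangle_ineq4[of "slope m - h (r m)" "slope (Suc m) - h (r m)"] by simp
  also have "\<dots> \<le> V (r (Suc m)) - V (r (m - 1))"
    using slope_near[OF m, of "r m"] slope_near[OF k, of "r m"] discrete_step(1)[OF m] discrete_step(1)[OF k]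
    by (simp add: Suc)
  finally have n: "norm (slope m - slope (Suc m)) \<le> V (r (Suc m)) - V (r (m - 1))" .
  have "(slope m - slope (Suc m)) (rate m) \<le> norm (slope m - slope (Suc m)) * norm (rate m)"
    using norm_blinfun[of "slope m - slope (Suc m)" "rate m"] by simp
  also have "\<dots> \<le> norm (slope m - slope (Suc m)) * 1"
    using norm_rate_le[of m] m by (intro mult_left_mono) auto
  finally show ?thesis using n by (simp add: blinfun.diff_left)
qed

section \<open>Summation of the force defects\<close>

text \<open>Division by the step length makes the sums telescope although the steps vary in
  length.\<close>

definition defect :: "nat \<Rightarrow> real" where
  "defect i = ((ell (r (Suc i)) - G (x (Suc i))) (rate (Suc i)) - (ell (r i) - G (x i)) (rate (Suc i)))
     / (r (Suc i) - r i)"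

lemma defect_nonneg:
  assumes "i < n" shows "0 \<le> defect i"
proof -
  have "(ell (r i) - G (x i)) (rate (Suc i)) \<le> (ell (r (Suc i)) - G (x (Suc i))) (rate (Suc i))"
    using discrete_stable[of i "rate (Suc i)"] rate_energy[OF assms] assms by simp
  then show ?thesis using discrete_step(1)[OF assms] by (simp add: defect_def)
qed

text \<open>
  Testing stability at time \<open>r (Suc m)\<close> with the old rate allows \<open>rate (Suc m)\<close> to be replaced by
  \<open>rate (Suc m) - rate m\<close>; the quadratic part of the product then telescopes by convexity and the
  load part by summation by parts.
\<close>

lemma defect_telescope:
  assumes m: "m < n"
  shows "defect m \<le> slope (Suc m) (rate (Suc m)) - slope m (rate m)
     - (H (x (Suc m)) (rate (Suc m)) (rate (Suc m)) - H (x m) (rate m) (rate m)) / 2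
     + (V (r (Suc m)) - V (r (m - 1))) + C * \<tau>"
proof -
  define d where "d = r (Suc m) - r m"
  define w where "w = rate (Suc m)"
  define v where "v = rate m"
  have d0: "0 < d" and d\<tau>: "d \<le> \<tau>" using discrete_step(1,2)[OF m] by (simp_all add: d_def)
  have w1: "norm w \<le> 1" and v1: "norm v \<le> 1" using norm_rate_le m by (simp_all add: w_def v_def)
  \<comment> \<open>The old force reaches the dissipation of the old rate, while stability bounds
    the new force by that same dissipation.\<close>
  have old: "(ell (r (Suc m)) - G (x (Suc m))) v \<le> (ell (r m) - G (x m)) v"
  proof (cases m)
    case 0
    then show ?thesis by (simp add: v_def rate_0)
  next
    case (Suc k)
    have "p v \<le> (ell (r m) - G (x m)) v" using rate_energy[of k] m Suc by (simp add: v_def)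
    then show ?thesis using discrete_stable[of "Suc m" v] m by simp
  qed
  obtain s where s: "0 < s" "s < 1"
    and G: "(G (x m + d *\<^sub>R w) - G (x m)) (w - v) = H (x m + s *\<^sub>R (d *\<^sub>R w)) (d *\<^sub>R w) (w - v)"
    by (rule G_increment)
  define q where "q = x m + s *\<^sub>R (d *\<^sub>R w)"
  have xm: "x (Suc m) - x m = d *\<^sub>R w" using rate_Suc[OF m] by (simp add: d_def w_def)
  have xS: "x (Suc m) = x m + d *\<^sub>R w" using xm by (metis add.commute diff_add_cancel)
  have q: "q \<in> cball (z (r m)) \<Delta>" using discrete_segment[OF m, of s] s by (simp add: q_def xm)
  have xmb: "x m \<in> cball (z (r m)) \<Delta>" using discrete_segment[OF m, of 0] by simp
  have xSb: "x (Suc m) \<in> cball (z (r m)) \<Delta>" using discrete_segment[OF m, of 1] by simp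
  have rm: "r m \<in> {0..T}" using discrete_time_range[of m] m by simp
  note ball = subsetD[OF z_ball[OF rm]]
  have dw: "norm (d *\<^sub>R w) \<le> \<tau>" using order_trans[OF mult_left_mono[OF w1 less_imp_le[OF d0]], of \<tau>] d0 d\<tau> by simp
  have sd: "norm (a *\<^sub>R (d *\<^sub>R w)) \<le> \<tau>" if "0 \<le> a" "a \<le> 1" for a
    using that dw mult_right_mono[of a 1 "norm (d *\<^sub>R w)"] by (metis abs_of_nonneg mult_1 norm_ge_zero norm_scaleR order_trans)
  have nq1: "norm (q - x m) \<le> \<tau>" using sd[of s] s by (simp add: q_def)
  have "x (Suc m) - q = (1 - s) *\<^sub>R (d *\<^sub>R w)" by (simp add: xS q_def algebra_simps)
  then have nq2: "norm (q - x (Suc m)) \<le> \<tau>" using sd[of "1 - s"] s by (simp add: norm_minus_commute[of q])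
  have slope: "(ell (r (Suc m)) - ell (r m)) u = d * slope (Suc m) u" for u
    using d0 by (simp add: slope_def d_def blinfun.scaleR_left)
  have "d * defect m = (ell (r (Suc m)) - G (x (Suc m))) w - (ell (r m) - G (x m)) w"
    using d0 by (simp add: defect_def d_def w_def)
  also have "\<dots> \<le> (ell (r (Suc m)) - G (x (Suc m))) (w - v) - (ell (r m) - G (x m)) (w - v)"
    using old by (simp add: blinfun.diff_right)
  also have "\<dots> = (ell (r (Suc m)) - ell (r m)) (w - v) - (G (x m + d *\<^sub>R w) - G (x m)) (w - v)"
    by (simp add: xS blinfun.diff_left)
  also have "\<dots> = d * (slope (Suc m) (w - v) - H q w (w - v))"
    unfolding slope G by (simp add: q_def blinfun.scaleR_right blinfun.scaleR_left right_diff_distrib)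
  finally have 1: "defect m \<le> slope (Suc m) (w - v) - H q w (w - v)" using d0 by simp
  have "0 \<le> H q (w - v) (w - v)"
    using H_conv[OF rm q, of "w - v"] pos(1) by (meson order_trans mult_nonneg_nonneg less_imp_le zero_le_power2)
  \<comment> \<open>By symmetry \<open>2 * H q w (w - v)\<close> is the difference of the quadratic
    forms at \<open>w\<close> and \<open>v\<close> plus the nonnegative form at
    \<open>w - v\<close>.\<close>
  then have 2: "(H q w w - H q v v) / 2 \<le> H q w (w - v)"
    by (simp add: blinfun.diff_left blinfun.diff_right H_sym[of q v w])
  have small: "C * \<tau> * norm u * norm u \<le> C * \<tau>" if "norm u \<le> 1" for u :: 'z
  proof -
    have "norm u * norm u \<le> 1" using that by (simp add: mult_le_one)
    then show ?thesis using pos d0 d\<tau> mult_left_le[of "norm u * norm u" "C * \<tau>"] by (simp add: mult.assoc)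
  qed
  \<comment> \<open>Moving \<open>q\<close> to either endpoint costs \<open>C * \<tau>\<close>; half
    the sum of both costs is the last term of the claim.\<close>
  have 3: "H (x (Suc m)) w w - C * \<tau> \<le> H q w w"
    using H_lip'[OF ball[OF q] ball[OF xSb] nq2, of w w] small[OF w1] by linarith
  have 4: "H q v v \<le> H (x m) v v + C * \<tau>"
    using H_lip'[OF ball[OF q] ball[OF xmb] nq1, of v v] small[OF v1] by linarith
  have 5: "slope m v - slope (Suc m) v \<le> V (r (Suc m)) - V (r (m - 1))"
    using slope_variation[OF m] by (simp add: v_def)
  show ?thesis
    using 1 2 3 4 5 unfolding w_def[symmetric] v_def[symmetric] blinfun.diff_right[of "slope (Suc m)"]
    by argo
qed

text \<open>The unions of adjacent intervals cover each interval at most twice, whence the factor 2.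
  At the end the Hessian term has a favourable sign by convexity and the slope term is at most
  \<open>\<Lambda>\<close>.\<close>

lemma defect_sum:
  "(\<Sum>i<n. defect i) \<le> \<Lambda> + 2 * (V T - V 0) + real n * C * \<tau>"
proof -
  have "(\<Sum>i<m. defect i) \<le> slope m (rate m) - H (x m) (rate m) (rate m) / 2
      + V (r m) + V (r (m - 1)) - 2 * V 0 + real m * C * \<tau>" if "m \<le> n" for m
    using that
  proof (induction m)
    case 0
    then show ?case by (simp add: rate_0 discrete_start)
  next
    case (Suc m)
    then show ?case using defect_telescope[of m] by (simp add: algebra_simps diff_divide_distrib)
  qed
  from this[of n] have 1: "(\<Sum>i<n. defect i) \<le> slope n (rate n) - H (x n) (rate n) (rate n) / 2
      + V (r n) + V (r (n - 1)) - 2 * V 0 + real n * C * \<tau>" by simp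
  have "slope n (rate n) \<le> norm (slope n) * norm (rate n)"
    using norm_blinfun[of "slope n" "rate n"] by simp
  also have "\<dots> \<le> \<Lambda> * 1" using norm_slope_le[of n] norm_rate_le[of n] pos by (intro mult_mono) auto
  finally have 2: "slope n (rate n) \<le> \<Lambda>" by simp
  have 3: "0 \<le> H (x n) (rate n) (rate n)"
  proof (cases n)
    case 0
    then show ?thesis by (simp add: rate_0)
  next
    case (Suc k)
    then have "x n \<in> cball (z (r k)) \<Delta>" using discrete_segment[of k 1] by simp
    from H_conv[OF discrete_time_range this] Suc pos(1) show ?thesis
      by (meson order_trans mult_nonneg_nonneg less_imp_le zero_le_power2 le_SucI order_refl)
  qed
  have 4: "V (r i) \<le> V T" if "i \<le> n" for i
    using discrete_time_range[OF that] by (intro mono_onD[OF V_mono]) auto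
  show ?thesis using 1 2 3 4[of n] 4[of "n - 1"] by simp
qed

lemma discrete_endpoint_near: "norm (x n - z (r n)) \<le> \<Delta>"
proof (cases n)
  case 0
  then show ?thesis using pos by (simp add: discrete_start)
next
  case (Suc k)
  have k: "k < n" using Suc by simp
  have "norm (z (r n) - z (r k)) \<le> L * (r n - r k)"
    using z_lip[of "r k" "r n"] discrete_time_range[of k] discrete_time_range[of n] discrete_step(1)[OF k] Suc
    by simp
  also have "\<dots> \<le> L * \<tau>" using discrete_step(2)[OF k] pos Suc by (intro mult_left_mono) auto
  finally have "norm (z (r n) - z (r k)) \<le> L * \<tau>" .
  moreover have "norm (x n - x k) \<le> \<tau>" using discrete_step(2,3)[OF k] Suc by simp
  moreover have "norm (x n - z (r n)) \<le> norm (x k - z (r k)) + norm (x n - x k) + norm (z (r n) - z (r k))"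
    using norm_triangle_ineq4[of "(x k - z (r k)) + (x n - x k)" "z (r n) - z (r k)"]
      norm_triangle_ineq[of "x k - z (r k)" "x n - x k"] by simp
  ultimately show ?thesis using discrete_step(5)[OF k] by (simp add: distrib_right)
qed

section \<open>Accumulation of the error over all steps\<close>

text \<open>The source term that \<open>step_error\<close> adds in step \<open>i\<close>.\<close>

definition increment :: "nat \<Rightarrow> real" where
  "increment i = 2 * ((ell (r (Suc i)) - G (x (Suc i))) (x (Suc i) - x i) - (ell (r i) - G (x i)) (x (Suc i) - x i))
     + 2 * (1 + L) * (2 * (V (r (Suc i)) - V (r i)) * (r (Suc i) - r i) + C * (r (Suc i) - r i)\<^sup>2) * (r (Suc i) - r i)"

text \<open>The product of force increment and step is \<open>defect i\<close> times the squared
  step length, and the interpolation error carries the same square.\<close>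

lemma increment_bounds:
  assumes i: "i < n"
  shows "0 \<le> increment i"
    "increment i \<le> (2 * defect i + 2 * (1 + L) * (2 * (V (r (Suc i)) - V (r i)) + C * \<tau>)) * \<tau>\<^sup>2"
proof -
  define d where "d = r (Suc i) - r i"
  define W where "W = V (r (Suc i)) - V (r i)"
  have d: "0 < d" "d \<le> \<tau>" using discrete_step(1,2)[OF i] by (simp_all add: d_def)
  have W: "0 \<le> W" using discrete_control_mono[of i "Suc i"] i by (simp add: W_def)
  have "(ell (r (Suc i)) - G (x (Suc i))) (x (Suc i) - x i) - (ell (r i) - G (x i)) (x (Suc i) - x i)
      = defect i * d\<^sup>2"
    using d unfolding rate_Suc[OF i] blinfun.scaleR_right defect_def d_def[symmetric]
    by (simp add: power2_eq_square right_diff_distrib[symmetric])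
  then have inc: "increment i = 2 * (defect i * d\<^sup>2) + 2 * (1 + L) * ((2 * W * d + C * d\<^sup>2) * d)"
    unfolding increment_def d_def[symmetric] W_def[symmetric] by simp
  have d2: "d\<^sup>2 \<le> \<tau>\<^sup>2" using d by (intro power_mono) auto
  have "(2 * W * d + C * d\<^sup>2) * d = (2 * W + C * d) * d\<^sup>2"
    by (simp add: power2_eq_square algebra_simps)
  also have "\<dots> \<le> (2 * W + C * \<tau>) * \<tau>\<^sup>2"
    using d d2 W pos by (intro mult_mono add_mono mult_left_mono) auto
  finally have "2 * (1 + L) * ((2 * W * d + C * d\<^sup>2) * d) \<le> 2 * (1 + L) * ((2 * W + C * \<tau>) * \<tau>\<^sup>2)"
    using pos by (intro mult_left_mono) auto
  moreover have "defect i * d\<^sup>2 \<le> defect i * \<tau>\<^sup>2"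
    using defect_nonneg[OF i] d2 by (rule mult_left_mono[rotated])
  ultimately show "increment i \<le> (2 * defect i + 2 * (1 + L) * (2 * (V (r (Suc i)) - V (r i)) + C * \<tau>)) * \<tau>\<^sup>2"
    unfolding inc W_def[symmetric] by (simp add: algebra_simps)
  show "0 \<le> increment i"
    unfolding inc using defect_nonneg[OF i] d W pos by simp
qed

text \<open>Iteration of \<open>step_error\<close> from zero initial error; the growth factors
  multiply to one exponential.\<close>

lemma err_sum:
  assumes "m \<le> n"
  shows "err (r m) (x m) \<le> exp (C * (1 + L) / \<kappa> * r m) * (\<Sum>i<m. increment i)"
  using assms
proof (induction m)
  case 0
  then show ?case by (simp add: discrete_start err_def)
next
  case (Suc m)
  have m: "m < n" using Suc by simp
  let ?c = "C * (1 + L) / \<kappa>" and ?d = "r (Suc m) - r m"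
  have rm: "0 \<le> r m" "r (Suc m) \<le> T" using discrete_time_range[of m] discrete_time_range[of "Suc m"] Suc by auto
  have c: "0 \<le> ?c" using pos by simp
  have "(1 + L) * ?d \<le> (1 + L) * \<tau>"
    using discrete_step(2)[OF m] pos by (intro mult_left_mono) auto
  then have near: "norm (x m - z (r m)) + (1 + L) * ?d \<le> \<Delta>" using discrete_step(5)[OF m] by linarith
  have "err (r (Suc m)) (x (Suc m)) \<le> exp (?c * ?d) * (err (r m) (x m) + increment m)"
    unfolding increment_def using m
    by (intro step_error rm near discrete_step discrete_stable) auto
  also have "\<dots> \<le> exp (?c * ?d) * (exp (?c * r m) * (\<Sum>i<m. increment i) + exp (?c * r m) * increment m)"
  proof (intro mult_left_mono add_mono)
    show "err (r m) (x m) \<le> exp (?c * r m) * (\<Sum>i<m. increment i)" using Suc by simp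
    have "1 \<le> exp (?c * r m)" using mult_nonneg_nonneg[OF c rm(1)] by simp
    from mult_right_mono[OF this increment_bounds(1)[OF m]]
    show "increment m \<le> exp (?c * r m) * increment m" by simp
  qed simp
  also have "\<dots> = (exp (?c * ?d) * exp (?c * r m)) * (\<Sum>i<Suc m. increment i)"
    by (simp add: algebra_simps)
  also have "exp (?c * ?d) * exp (?c * r m) = exp (?c * r (Suc m))"
    by (simp only: exp_add[symmetric] distrib_left[symmetric] diff_add_cancel)
  finally show ?case .
qed

text \<open>The increments sum to a multiple of \<open>\<tau>\<^sup>2\<close>, and coercivity of the
  error form turns this into first order for the norm. \<open>D\<close> controls the Hessian errors,
  which are of order \<open>\<tau>\<close> in each of the \<open>n\<close> defects.\<close>

lemma discrete_error:
  assumes D: "real n * \<tau> \<le> D"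
  shows "norm (x n - z (r n)) \<le> sqrt (exp (C * (1 + L) / \<kappa> * T) *
     (2 * (\<Lambda> + 2 * (V T - V 0) + C * D) + 2 * (1 + L) * (2 * (V T - V 0) + C * D)) / \<kappa>) * \<tau>"
proof -
  define Q where "Q = 2 * (\<Lambda> + 2 * (V T - V 0) + C * D) + 2 * (1 + L) * (2 * (V T - V 0) + C * D)"
  let ?c = "C * (1 + L) / \<kappa>"
  have \<tau>: "0 < \<tau>" by (rule discrete_start)
  have c: "0 \<le> ?c" using pos by simp
  have rn: "0 \<le> r n" "r n \<le> T" using discrete_time_range[of n] by auto
  have Vn: "V (r n) \<le> V T" using rn by (intro mono_onD[OF V_mono]) auto
  have CD: "real n * C * \<tau> \<le> C * D" using mult_left_mono[OF D pos(5)] by (simp add: mult_ac)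
  have "(\<Sum>i<n. increment i) \<le> (\<Sum>i<n. (2 * defect i + 2 * (1 + L) * (2 * (V (r (Suc i)) - V (r i)) + C * \<tau>)) * \<tau>\<^sup>2)"
    by (intro sum_mono increment_bounds) simp
  also have "\<dots> = (2 * (\<Sum>i<n. defect i) + 2 * (1 + L) * (2 * (\<Sum>i<n. V (r (Suc i)) - V (r i)) + real n * C * \<tau>)) * \<tau>\<^sup>2"
    unfolding sum_distrib_right[symmetric] sum.distrib sum_distrib_left[symmetric] by simp
  also have "(\<Sum>i<n. V (r (Suc i)) - V (r i)) = V (r n) - V 0"
    by (subst sum_lessThan_telescope) (simp add: discrete_start)
  also have "(2 * (\<Sum>i<n. defect i) + 2 * (1 + L) * (2 * (V (r n) - V 0) + real n * C * \<tau>)) * \<tau>\<^sup>2 \<le> Q * \<tau>\<^sup>2"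
    unfolding Q_def using defect_sum CD Vn pos by (intro mult_right_mono add_mono mult_left_mono) auto
  finally have S: "(\<Sum>i<n. increment i) \<le> Q * \<tau>\<^sup>2" .
  have S0: "0 \<le> (\<Sum>i<n. increment i)" by (intro sum_nonneg increment_bounds) simp
  have "\<kappa> * (norm (x n - z (r n)))\<^sup>2 \<le> err (r n) (x n)"
    using discrete_endpoint_near rn by (intro err_coercive) auto
  also have "\<dots> \<le> exp (?c * r n) * (\<Sum>i<n. increment i)" by (rule err_sum) simp
  also have "\<dots> \<le> exp (?c * T) * (Q * \<tau>\<^sup>2)"
  proof (rule mult_mono[OF _ S _ S0])
    show "exp (?c * r n) \<le> exp (?c * T)"
      unfolding exp_le_cancel_iff by (rule mult_left_mono[OF rn(2) c])
  qed simp
  finally have "(norm (x n - z (r n)))\<^sup>2 \<le> exp (?c * T) * Q / \<kappa> * \<tau>\<^sup>2"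
    using pos(1) by (simp add: field_simps)
  then have "norm (x n - z (r n)) \<le> sqrt (exp (?c * T) * Q / \<kappa> * \<tau>\<^sup>2)"
    by (rule real_le_rsqrt)
  also have "\<dots> = sqrt (exp (?c * T) * Q / \<kappa>) * \<tau>"
    unfolding real_sqrt_mult[of _ "\<tau>\<^sup>2"] using \<tau> by simp
  finally show ?thesis unfolding Q_def .
qed

end

end

section \<open>Derivatives of the energy and the dissipation\<close>

context rate_independent_system
begin

definition grad :: "'z \<Rightarrow> 'z \<Rightarrow>\<^sub>L real" where
  "grad u = A u + fderiv F u"

definition hess :: "'z \<Rightarrow> 'z \<Rightarrow>\<^sub>L ('z \<Rightarrow>\<^sub>L real)" where
  "hess u = A + fderiv (fderiv F) u"

definition load :: "real \<Rightarrow> 'z \<Rightarrow>\<^sub>L real" where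
  "load t = l t o\<^sub>L j"

definition diss :: "'z \<Rightarrow> real" where
  "diss v = R (j v)"

lemma F_has_derivative: "(F has_derivative fderiv F u) (at u)"
  using F_C2 by (auto simp: C2_map_def C1_map_def intro: has_derivative_fderiv)

lemma grad_has_derivative: "(grad has_derivative hess u) (at u)"
proof -
  have "(fderiv F has_derivative fderiv (fderiv F) u) (at u)"
    using F_C2 by (auto simp: C2_map_def C1_map_def intro: has_derivative_fderiv)
  then show ?thesis
    unfolding grad_def[abs_def] hess_def
    by (auto intro!: derivative_eq_intros simp: blinfun.add_left)
qed

lemma energy_has_derivative: "(energy j A F l t has_derivative (grad u - load t)) (at u)"
proof -
  have A: "((\<lambda>z. A z z) has_derivative (\<lambda>h. A u h + A h u)) (at u)"
    by (rule has_derivative_eq_rhs[OF bounded_bilinear.FDERIV[OF bounded_bilinear_blinfun_apply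
      bounded_linear_imp_has_derivative[OF blinfun.bounded_linear_right] has_derivative_ident]]) simp
  show ?thesis
    unfolding energy_def[abs_def] grad_def load_def
    by (rule derivative_eq_intros A F_has_derivative refl)+
      (auto simp: fun_eq_iff A_selfadjoint blinfun.diff_left blinfun.add_left)
qed

lemma D_energy_eq: "D_energy j A F l t u = grad u - load t"
  unfolding D_energy_def by (rule fderiv_eqI[OF energy_has_derivative])

lemma D2_energy_eq: "D2_energy j A F l t u = hess u"
proof -
  have "D_energy j A F l t = (\<lambda>u. grad u - load t)" by (simp add: fun_eq_iff D_energy_eq)
  then show ?thesis
    unfolding D2_energy_def
    by (auto intro!: fderiv_eqI derivative_eq_intros grad_has_derivative)
qed

lemma hess_sym: "hess u v w = hess u w v"
proof (rule second_derivative_symmetric[where f = "energy j A F l 0" and G = "\<lambda>u. grad u - load 0"])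
  show "(energy j A F l 0 has_derivative (grad u - load 0)) (at u)" for u
    by (rule energy_has_derivative)
  show "((\<lambda>u. grad u - load 0) has_derivative hess u) (at u)" for u
    by (auto intro!: derivative_eq_intros grad_has_derivative)
  have "isCont (fderiv (fderiv F)) u"
    using F_C2 by (auto simp: C2_map_def C1_map_def continuous_on_eq_continuous_at)
  then show "isCont hess u" unfolding hess_def[abs_def] by (intro continuous_intros)
qed

text \<open>The assumed estimate is one-sided and on the diagonal. Exchanging \<open>a\<close> and
  \<open>b\<close> yields the absolute value, polarization all pairs \<open>v\<close>,
  \<open>w\<close>.\<close>

lemma hess_locally_lipschitz:
  assumes "0 < \<rho>"
  obtains C where "0 \<le> C"
    "\<And>a b v w. a \<in> ball 0 \<rho> \<Longrightarrow> b \<in> ball 0 \<rho> \<Longrightarrow> \<bar>hess a v w - hess b v w\<bar> \<le> C * norm (a - b) * norm v * norm w"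
proof -
  obtain C where C: "0 \<le> C" and le: "\<And>a b v :: 'z. a \<in> ball 0 \<rho> \<Longrightarrow> b \<in> ball 0 \<rho> \<Longrightarrow>
      (hess a - hess b) v v \<le> C * norm (a - b) * (norm v)\<^sup>2"
    using energy_C21_loc[OF assms] T_pos unfolding D2_energy_eq by fastforce
  show ?thesis
  proof (rule that[OF C])
    fix a b v w :: 'z assume ab: "a \<in> ball 0 \<rho>" "b \<in> ball 0 \<rho>"
    have "\<bar>(hess a - hess b) v w\<bar> \<le> C * norm (a - b) * norm v * norm w"
    proof (rule symmetric_bilinear_bound)
      show "(hess a - hess b) x y = (hess a - hess b) y x" for x y
        by (simp add: blinfun.diff_left hess_sym[of _ x y])
      show "\<bar>(hess a - hess b) x x\<bar> \<le> C * norm (a - b) * (norm x)\<^sup>2" for x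
        using le[OF ab, of x] le[OF ab(2,1), of x] by (simp add: blinfun.diff_left norm_minus_commute)
    qed
    then show "\<bar>hess a v w - hess b v w\<bar> \<le> C * norm (a - b) * norm v * norm w"
      by (simp add: blinfun.diff_left)
  qed
qed

section \<open>The dissipation and the load on the state space\<close>

lemma R_0: "R 0 = 0"
  using R_bounds R_nonneg[of 0] by (metis mult_zero_right norm_zero order_antisym)

lemma R_scale: "0 \<le> c \<Longrightarrow> R (c *\<^sub>R v) = c * R v"
  using R_homogeneous[of c v] R_0 by (cases "c = 0") auto

lemma R_add: "R (v + w) \<le> R v + R w"
proof -
  have "R ((1 - 1/2) *\<^sub>R v + (1/2) *\<^sub>R w) \<le> (1 - 1/2) * R v + (1/2) * R w"
    by (rule convex_onD[OF R_convex]) auto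
  moreover have "v + w = 2 *\<^sub>R ((1 - 1/2) *\<^sub>R v + (1/2) *\<^sub>R w)" by (simp add: scaleR_add_right)
  ultimately show ?thesis using R_scale[of 2 "(1 - 1/2) *\<^sub>R v + (1/2) *\<^sub>R w"] by simp
qed

lemma diss_add: "diss (v + w) \<le> diss v + diss w"
  unfolding diss_def blinfun.add_right by (rule R_add)

lemma diss_scale: "0 \<le> c \<Longrightarrow> diss (c *\<^sub>R v) = c * diss v"
  unfolding diss_def blinfun.scaleR_right by (rule R_scale)

lemma diss_nonneg: "0 \<le> diss v"
  unfolding diss_def by (rule R_nonneg)

lemma diss_bound: obtains K where "0 \<le> K" "\<And>v. diss v \<le> K * norm v"
proof -
  obtain K where K: "0 < K" "\<And>v. R v \<le> K * norm v" using R_bounds by blast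
  show ?thesis
  proof (rule that)
    show "diss v \<le> K * norm v" for v
      unfolding diss_def using K(2)[of "j v"] mult_left_mono[OF j_normalized[of v], of K] K(1) by linarith
  qed (use K in simp)
qed

lemma norm_blinfun_compose_embedding: "norm (x o\<^sub>L j) \<le> norm x"
proof -
  have "norm (x o\<^sub>L j) \<le> norm x * norm j" by (rule norm_blinfun_compose)
  also have "norm j \<le> 1" using j_normalized by (intro norm_blinfun_bound) auto
  finally show ?thesis by (simp add: mult_left_mono)
qed

lemma norm_load_diff_le: "norm (load t - load s) \<le> norm (l t - l s)"
  using norm_blinfun_compose_embedding[of "l t - l s"]
  unfolding load_def by (simp add: bounded_bilinear.diff_left[OF bounded_bilinear_blinfun_compose])

text \<open>For a one-homogeneous potential the inclusion splits into stability and full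
  dissipation, by testing with \<open>w + v\<close> and with 0.\<close>

lemma zero_in_subdiff_plusD:
  assumes "zero_in_subdiff_plus j R w \<xi>"
  shows "- \<xi> v \<le> diss v" "diss w \<le> - \<xi> w"
proof -
  have *: "diss w - \<xi> (u - w) \<le> diss u" for u
    using assms by (simp add: zero_in_subdiff_plus_def diss_def)
  show "diss w \<le> - \<xi> w" using *[of 0] diss_scale[of 0 w] by (simp add: blinfun.minus_right)
  have "diss w - \<xi> ((w + v) - w) \<le> diss (w + v)" by (rule *)
  then show "- \<xi> v \<le> diss v" using diss_add[of w v] by simp
qed

section \<open>Properties of the solution\<close>

lemma hess_bounded:
  assumes "0 < \<rho>"
  obtains K where "0 \<le> K" "\<And>u. u \<in> ball 0 \<rho> \<Longrightarrow> norm (hess u) \<le> K"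
proof -
  obtain C where C: "0 \<le> C" "\<And>a b v w :: 'z. a \<in> ball 0 \<rho> \<Longrightarrow> b \<in> ball 0 \<rho> \<Longrightarrow>
      \<bar>hess a v w - hess b v w\<bar> \<le> C * norm (a - b) * norm v * norm w"
    using hess_locally_lipschitz[OF assms] by blast
  have "norm (hess u - hess 0) \<le> C * \<rho>" if u: "u \<in> ball 0 \<rho>" for u
  proof (intro norm_blinfun_bound)
    fix v w
    have "norm ((hess u - hess 0) v w) \<le> C * norm u * norm v * norm w"
      using C(2)[OF u, of 0 v w] assms by (simp add: blinfun.diff_left)
    also have "\<dots> \<le> C * \<rho> * norm v * norm w"
      using u C(1) by (intro mult_right_mono mult_left_mono) auto
    finally show "norm ((hess u - hess 0) v w) \<le> C * \<rho> * norm v * norm w" .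
  qed (use C(1) assms in auto)
  then have "norm (hess u) \<le> norm (hess 0) + C * \<rho>" if "u \<in> ball 0 \<rho>" for u
    using norm_triangle_sub[of "hess u" "hess 0"] that by fastforce
  then show ?thesis using C(1) assms by (intro that[of "norm (hess 0) + C * \<rho>"]) auto
qed

lemma grad_lipschitz:
  assumes "0 < \<rho>"
  obtains K where "0 \<le> K" "\<And>a b. a \<in> ball 0 \<rho> \<Longrightarrow> b \<in> ball 0 \<rho> \<Longrightarrow> norm (grad a - grad b) \<le> K * norm (a - b)"
proof -
  obtain K where K: "0 \<le> K" "\<And>u. u \<in> ball 0 \<rho> \<Longrightarrow> norm (hess u) \<le> K"
    using hess_bounded[OF assms] by blast
  show ?thesis
  proof (rule that[OF K(1)])
    fix a b :: 'z assume ab: "a \<in> ball 0 \<rho>" "b \<in> ball 0 \<rho>"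
    show "norm (grad a - grad b) \<le> K * norm (a - b)"
      by (rule differentiable_bound[OF convex_ball _ _ ab, where f' = "\<lambda>u. hess u"])
        (use K grad_has_derivative in \<open>auto intro: has_derivative_at_withinI simp: norm_blinfun.rep_eq[symmetric]\<close>)
  qed
qed

lemma load_lipschitz:
  assumes "\<Lambda>-lipschitz_on {0..T} l" "s \<in> {0..T}" "t \<in> {0..T}"
  shows "norm (load t - load s) \<le> \<Lambda> * \<bar>t - s\<bar>"
  using norm_load_diff_le[of t s] lipschitz_onD[OF assms(1,3,2)] by (simp add: dist_norm)

text \<open>Stability holds almost everywhere and extends by continuity of the driving force. In the
  energy balance the force is frozen at time \<open>r\<close>; its Lipschitz constant
  \<open>Z\<close> bounds the resulting error, so \<open>M\<close> is \<open>Z\<close> times a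
  primitive of the norm of the derivative.\<close>

lemma solution_properties:
  assumes sol: "differential_solution T j A F l R z0 z"
    and lip: "L-lipschitz_on {0..T} z"
    and ball: "\<And>t. t \<in> {0..T} \<Longrightarrow> z t \<in> ball 0 \<rho>"
  obtains M where "mono_on {0..T} M"
    "\<And>t v. t \<in> {0..T} \<Longrightarrow> (load t - grad (z t)) v \<le> diss v"
    "\<And>s r t. 0 \<le> s \<Longrightarrow> s \<le> r \<Longrightarrow> r \<le> t \<Longrightarrow> t \<le> T \<Longrightarrow>
      diss (z t - z s) \<le> (load r - grad (z r)) (z t - z s) + (t - s) * (M t - M s)"
proof -
  have \<rho>: "0 < \<rho>" using ball[of 0] T_pos by (auto intro: le_less_trans[OF norm_ge_zero])
  obtain K where K: "0 \<le> K" "\<And>a b. a \<in> ball 0 \<rho> \<Longrightarrow> b \<in> ball 0 \<rho> \<Longrightarrow> norm (grad a - grad b) \<le> K * norm (a - b)"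
    using grad_lipschitz[OF \<rho>] by blast
  obtain \<Lambda> where \<Lambda>: "\<Lambda>-lipschitz_on {0..T} l" using l_Lipschitz by blast
  define \<zeta> where "\<zeta> t = load t - grad (z t)" for t
  define Z where "Z = \<Lambda> + K * L"
  have \<zeta>_lip: "norm (\<zeta> t - \<zeta> s) \<le> Z * \<bar>t - s\<bar>" if st: "s \<in> {0..T}" "t \<in> {0..T}" for s t
  proof -
    have "norm (\<zeta> t - \<zeta> s) \<le> norm (load t - load s) + norm (grad (z t) - grad (z s))"
      using norm_triangle_ineq4[of "load t - load s" "grad (z t) - grad (z s)"] by (simp add: \<zeta>_def algebra_simps)
    also have "norm (grad (z t) - grad (z s)) \<le> K * norm (z t - z s)"
      using ball st by (intro K) auto
    also have "\<dots> \<le> K * (L * \<bar>t - s\<bar>)"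
      using lipschitz_onD[OF lip st(2,1)] K(1) by (intro mult_left_mono) (auto simp: dist_norm)
    finally show ?thesis using load_lipschitz[OF \<Lambda> st] by (simp add: Z_def algebra_simps)
  qed
  have Z0: "0 \<le> Z" using \<Lambda> lip K(1) by (auto simp: Z_def dest!: lipschitz_on_nonneg)
  obtain z' where z': "W11_deriv T z z'"
    and AE: "AE t in lebesgue_on {0..T}. zero_in_subdiff_plus j R (z' t) (D_energy j A F l t (z t))"
    using sol unfolding differential_solution_def by blast
  obtain N where N: "negligible N"
    and incl: "\<And>t. t \<in> {0..T} - N \<Longrightarrow> zero_in_subdiff_plus j R (z' t) (D_energy j A F l t (z t))"
    using AE_lebesgue_on_negligible[OF AE] by auto
  have stab: "\<zeta> t v \<le> diss v" and en: "diss (z' t) \<le> \<zeta> t (z' t)" if "t \<in> {0..T} - N" for t v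
    using zero_in_subdiff_plusD[OF incl[OF that]] by (auto simp: D_energy_eq \<zeta>_def blinfun.diff_left)
  have stable: "\<zeta> t v \<le> diss v" if t: "t \<in> {0..T}" for t v
  proof -
    \<comment> \<open>The times at which stability holds for this \<open>v\<close> form a closed set
      containing almost every point of the interval, hence all of it.\<close>
    define D where "D = {0..T} \<inter> (\<lambda>t. \<zeta> t v) -` {..diss v}"
    have "Z-lipschitz_on {0..T} \<zeta>"
      using \<zeta>_lip Z0 by (intro lipschitz_onI) (auto simp: dist_norm)
    then have "continuous_on {0..T} \<zeta>" by (rule lipschitz_on_continuous_on)
    then have "continuous_on {0..T} (\<lambda>t. \<zeta> t v)" by (intro continuous_intros)
    then have D: "closed D"
      unfolding D_def by (intro continuous_closed_preimage) auto
    have "t \<in> N" if "t \<in> {0<..<T}" "t \<notin> D" for t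
      using stab[of t v] that by (cases "t \<in> N") (auto simp: D_def)
    then have "AE t in lebesgue. t \<in> {0<..<T} \<longrightarrow> t \<in> D"
      using N unfolding negligible_iff_null_sets by (intro AE_I'[of N]) auto
    from mem_closed_if_AE_lebesgue_open[OF open_greaterThanLessThan D this]
    have "{0<..<T} \<subseteq> D" by (rule subsetI)
    then have "closure {0<..<T} \<subseteq> D" using D by (rule closure_minimal)
    then show ?thesis using t T_pos by (auto simp: D_def)
  qed
  \<comment> \<open>Resetting the derivative to 0 on the null set makes the pointwise estimate valid
    at every time.\<close>
  define y where "y t = (if t \<in> N then 0 else z' t)" for t
  have y: "(y has_integral z t - z s) {s..t}" if "0 \<le> s" "s \<le> t" "t \<le> T" for s t
  proof (rule has_integral_spike[OF N])
    have "\<And>t. t \<in> {0..T} \<Longrightarrow> (z' has_integral z t - z 0) {0..t}"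
      using z' unfolding W11_deriv_def by blast
    from has_integral_increment_inner[OF this that]
    show "(z' has_integral z t - z s) {s..t}" .
  qed (simp add: y_def)
  define m where "m t = integral {0..t} (\<lambda>t. norm (z' t))" for t
  have int: "(\<lambda>t. norm (z' t)) integrable_on {0..T}"
    using z' unfolding W11_deriv_def by (blast intro: set_lebesgue_integral_eq_integral(1))
  have m: "((\<lambda>t. norm (z' t)) has_integral m t - m s) {s..t}" if "0 \<le> s" "s \<le> t" "t \<le> T" for s t
  proof (rule has_integral_increment[where T = T])
    fix r assume "r \<in> {0..T}"
    then have "(\<lambda>t. norm (z' t)) integrable_on {0..r}"
      using int by (auto intro: integrable_subinterval_real)
    then show "((\<lambda>t. norm (z' t)) has_integral m r - m 0) {0..r}"
      by (simp add: m_def has_integral_integral)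
  qed (use that in auto)
  have ny: "((\<lambda>t. norm (y t)) has_integral m t - m s) {s..t}" if "0 \<le> s" "s \<le> t" "t \<le> T" for s t
    by (rule has_integral_spike[OF N _ m[OF that]]) (simp add: y_def)
  obtain Kd where Kd: "\<And>v. diss v \<le> Kd * norm v" using diss_bound by blast
  show ?thesis
  proof (rule that[of "\<lambda>t. Z * m t"])
    show "mono_on {0..T} (\<lambda>t. Z * m t)"
    proof (rule mono_onI)
      fix s t assume "s \<in> {0..T}" "t \<in> {0..T}" "s \<le> t"
      then have "0 \<le> m t - m s" using m[of s t] by (intro has_integral_nonneg[OF m]) auto
      then show "Z * m s \<le> Z * m t" using Z0 by (intro mult_left_mono) auto
    qed
    show "(load t - grad (z t)) v \<le> diss v" if "t \<in> {0..T}" for t v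
      using stable[OF that] by (simp add: \<zeta>_def)
    fix s r t :: real assume srt: "0 \<le> s" "s \<le> r" "r \<le> t" "t \<le> T"
    have "diss (z t - z s) - \<zeta> r (z t - z s) \<le> Z * (t - s) * (m t - m s)"
    proof (rule has_integral_sublinear_le[where q = "\<lambda>v. diss v - \<zeta> r v" and K = "Kd + norm (\<zeta> r)"])
      show "(y has_integral z t - z s) {s..t}"
        by (rule y[OF srt(1) order_trans[OF srt(2,3)] srt(4)])
      show "((\<lambda>t'. Z * (t - s) * norm (y t')) has_integral Z * (t - s) * (m t - m s)) {s..t}"
        using srt by (intro has_integral_mult_right ny) auto
      show "diss (y q) - \<zeta> r (y q) \<le> Z * (t - s) * norm (y q)" if q: "q \<in> {s..t}" for q
      proof (cases "q \<in> N")
        case True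
        then show ?thesis using diss_scale[of 0 0] by (simp add: y_def blinfun.zero_right)
      next
        case False
        have "diss (y q) - \<zeta> r (y q) \<le> (\<zeta> q - \<zeta> r) (y q)"
          using en[of q] False q srt by (simp add: y_def blinfun.diff_left)
        also have "\<dots> \<le> norm (\<zeta> q - \<zeta> r) * norm (y q)"
          using norm_blinfun[of "\<zeta> q - \<zeta> r" "y q"] by simp
        also have "\<dots> \<le> Z * \<bar>q - r\<bar> * norm (y q)"
          using q srt by (intro mult_right_mono \<zeta>_lip) auto
        also have "\<dots> \<le> Z * (t - s) * norm (y q)"
          using q srt Z0 by (intro mult_right_mono mult_left_mono) auto
        finally show ?thesis .
      qed
      show "diss (v + w) - \<zeta> r (v + w) \<le> diss v - \<zeta> r v + (diss w - \<zeta> r w)" for v w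
        using diss_add[of v w] by (simp add: blinfun.add_right)
      show "diss (c *\<^sub>R v) - \<zeta> r (c *\<^sub>R v) = c * (diss v - \<zeta> r v)" if "0 \<le> c" for c v
        using that by (simp add: diss_scale blinfun.scaleR_right right_diff_distrib)
      show "diss v - \<zeta> r v \<le> (Kd + norm (\<zeta> r)) * norm v" for v
        using Kd[of v] norm_blinfun[of "\<zeta> r" v] by (simp add: distrib_right)
    qed
    moreover have "(t - s) * (Z * m t - Z * m s) = Z * (t - s) * (m t - m s)"
      by (simp add: algebra_simps)
    ultimately show "diss (z t - z s) \<le> (load r - grad (z r)) (z t - z s) + (t - s) * (Z * m t - Z * m s)"
      unfolding \<zeta>_def by argo
  qed
qed

section \<open>The constrained incremental problem\<close>

lemma DF_lipschitz:
  assumes "0 < \<rho>"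
  obtains K where "0 \<le> K" "\<And>a b. a \<in> ball 0 \<rho> \<Longrightarrow> b \<in> ball 0 \<rho> \<Longrightarrow> norm (DF a - DF b) \<le> K * norm (a - b)"
proof -
  obtain C q where q: "1 \<le> q" and le: "\<And>u v. norm (fderiv DF u v) \<le> C * (1 + norm u powr q) * norm v"
    using D2F_bound by blast
  define K where "K = \<bar>C\<bar> * (1 + \<rho> powr q)"
  have K0: "0 \<le> K" by (simp add: K_def)
  have bound: "norm (fderiv DF u) \<le> K" if u: "u \<in> ball 0 \<rho>" for u
  proof (rule norm_blinfun_bound[OF K0])
    fix v
    have "norm (fderiv DF u v) \<le> C * (1 + norm u powr q) * norm v" by (rule le)
    also have "\<dots> \<le> \<bar>C\<bar> * (1 + \<rho> powr q) * norm v"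
      using u q by (intro mult_right_mono mult_mono add_mono powr_mono2) auto
    finally show "norm (fderiv DF u v) \<le> K * norm v" by (simp add: K_def)
  qed
  have deriv: "(DF has_derivative fderiv DF u) (at u within S)" for u S
    using DF_C1 by (auto simp: C1_map_def intro: has_derivative_at_withinI has_derivative_fderiv)
  show ?thesis
  proof (rule that[OF K0])
    fix a b :: 'z assume ab: "a \<in> ball 0 \<rho>" "b \<in> ball 0 \<rho>"
    show "norm (DF a - DF b) \<le> K * norm (a - b)"
      by (rule differentiable_bound[OF convex_ball deriv _ ab])
        (use bound in \<open>auto simp: norm_blinfun.rep_eq[symmetric]\<close>)
  qed
qed

lemma F_increment:
  obtains s where "0 < s" "s < 1" "F (y + w) - F y = DF (y + s *\<^sub>R w) (j w)"
proof -
  have "((\<lambda>s. F (y + s *\<^sub>R w)) has_real_derivative fderiv F (y + s *\<^sub>R w) w) (at s)" for s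
    by (rule real_derivative_line[OF F_has_derivative])
  then have "\<exists>s. 0 < s \<and> s < 1 \<and> F (y + 1 *\<^sub>R w) - F (y + 0 *\<^sub>R w) = (1 - 0) * fderiv F (y + s *\<^sub>R w) w"
    by (intro MVT2) auto
  then show ?thesis using that by (auto simp: DF_deriv)
qed

lemma energy_increment:
  "energy j A F l t (y + w) - energy j A F l t y
    = (grad y - load t) w + A w w / 2 + (F (y + w) - F y - DF y (j w))"
  by (simp add: energy_def grad_def load_def DF_deriv blinfun.add_left blinfun.add_right blinfun.diff_left
      A_selfadjoint[of w y] algebra_simps)

text \<open>
  The constraint bounds a step only in the weaker norm. Coercivity of \<open>A\<close> upgrades this to the
  stronger norm, because \<open>DF\<close> takes values in the dual of the weaker space: the Taylor remainder of
  \<open>F\<close> is bounded by a multiple of the product of both norms of the step.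
\<close>

lemma constrained_step_bound:
  assumes \<rho>: "0 < \<rho>"
  obtains c where "0 \<le> c"
    "\<And>s t \<tau> y u. s \<in> {0..T} \<Longrightarrow> t \<in> {0..T} \<Longrightarrow> \<bar>t - s\<bar> \<le> \<tau> \<Longrightarrow> \<tau> \<le> 1 \<Longrightarrow> y \<in> ball 0 \<rho> \<Longrightarrow>
      \<forall>v. (load s - grad y) v \<le> diss v \<Longrightarrow> norm (j (u - y)) \<le> \<tau> \<Longrightarrow>
      energy j A F l t u + diss (u - y) \<le> energy j A F l t y \<Longrightarrow> norm (u - y) \<le> c * \<tau>"
proof -
  obtain \<alpha> where \<alpha>: "0 < \<alpha>" "\<And>v. \<alpha> * (norm v)\<^sup>2 \<le> A v v" using A_coercive by blast
  obtain \<Lambda> where \<Lambda>: "\<Lambda>-lipschitz_on {0..T} l" using l_Lipschitz by blast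
  have \<Lambda>0: "0 \<le> \<Lambda>" using \<Lambda> by (rule lipschitz_on_nonneg)
  obtain K1 where K1: "0 \<le> K1" "\<And>a b. a \<in> ball 0 \<rho> \<Longrightarrow> b \<in> ball 0 \<rho> \<Longrightarrow> norm (DF a - DF b) \<le> K1 * norm (a - b)"
    using DF_lipschitz[OF \<rho>] by blast
  \<comment> \<open>\<open>lm\<close> bounds the loads and \<open>Fm\<close> bounds \<open>F\<close>
    on the ball of radius \<open>\<rho>\<close>. \<open>E\<close> then bounds half the quadratic
    form of \<open>A\<close> at the new state, and the ball of radius \<open>\<sigma>\<close>
    contains both the old and the new state.\<close>
  define lm where "lm = norm (l 0) + \<Lambda> * T"
  define Fm where "Fm = F 0 + (norm (DF 0) + K1 * \<rho>) * \<rho>"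
  define E where "E = norm A * \<rho>\<^sup>2 / 2 + Fm + lm"
  define \<sigma> where "\<sigma> = \<rho> + sqrt (2 * E / \<alpha>) + 1"
  have F_le: "F y \<le> Fm" if y: "y \<in> ball 0 \<rho>" for y
  proof -
    obtain s where s: "0 < s" "s < 1" "F (0 + y) - F 0 = DF (0 + s *\<^sub>R y) (j y)"
      by (rule F_increment)
    have "norm (s *\<^sub>R y) \<le> 1 * norm y" unfolding norm_scaleR using s by (intro mult_right_mono) auto
    then have sy: "norm (s *\<^sub>R y) < \<rho>" using y by simp
    have "norm (DF (s *\<^sub>R y)) \<le> norm (DF 0) + norm (DF (s *\<^sub>R y) - DF 0)"
      using norm_triangle_sub[of "DF (s *\<^sub>R y)" "DF 0"] by simp
    also have "norm (DF (s *\<^sub>R y) - DF 0) \<le> K1 * norm (s *\<^sub>R y - 0)"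
      using sy \<rho> by (intro K1) auto
    also have "\<dots> \<le> K1 * \<rho>" using sy K1(1) by (intro mult_left_mono) auto
    finally have d: "norm (DF (s *\<^sub>R y)) \<le> norm (DF 0) + K1 * \<rho>" by simp
    have "DF (s *\<^sub>R y) (j y) \<le> norm (DF (s *\<^sub>R y)) * norm (j y)"
      using norm_blinfun[of "DF (s *\<^sub>R y)" "j y"] by simp
    also have "\<dots> \<le> (norm (DF 0) + K1 * \<rho>) * \<rho>"
      using d K1(1) \<rho> y j_normalized[of y] by (intro mult_mono) auto
    finally show ?thesis using s(3) by (simp add: Fm_def)
  qed
  have Fm0: "0 \<le> Fm" using F_nonneg[of 0] F_le[of 0] \<rho> by simp
  have lm0: "0 \<le> lm" using \<Lambda>0 T_pos by (simp add: lm_def)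
  have E0: "0 \<le> E" using Fm0 lm0 by (simp add: E_def)
  have l_le: "norm (l t) \<le> lm" if t: "t \<in> {0..T}" for t
  proof -
    have "norm (l t - l 0) \<le> \<Lambda> * t"
      using lipschitz_onD[OF \<Lambda> t, of 0] t by (simp add: dist_norm)
    also have "\<dots> \<le> \<Lambda> * T" using t \<Lambda>0 by (intro mult_left_mono) auto
    finally show ?thesis using norm_triangle_sub[of "l t" "l 0"] by (simp add: lm_def)
  qed
  have \<sigma>: "0 < \<sigma>" "\<rho> \<le> \<sigma>" using \<rho> E0 \<alpha>(1) by (auto simp: \<sigma>_def add_pos_nonneg)
  obtain K where K: "0 \<le> K" "\<And>a b. a \<in> ball 0 \<sigma> \<Longrightarrow> b \<in> ball 0 \<sigma> \<Longrightarrow> norm (DF a - DF b) \<le> K * norm (a - b)"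
    using DF_lipschitz[OF \<sigma>(1)] by blast
  show ?thesis
  proof (rule that)
    show "0 \<le> 2 * (K + \<Lambda>) / \<alpha>" using K(1) \<Lambda>0 \<alpha>(1) by simp
    fix s t \<tau> y u
    assume s: "s \<in> {0..T}" and t: "t \<in> {0..T}" and st: "\<bar>t - s\<bar> \<le> \<tau>" and \<tau>: "\<tau> \<le> 1"
      and y: "y \<in> ball 0 \<rho>" and stable: "\<forall>v. (load s - grad y) v \<le> diss v"
      and ju: "norm (j (u - y)) \<le> \<tau>"
      and min: "energy j A F l t u + diss (u - y) \<le> energy j A F l t y"
    define w where "w = u - y"
    have u: "u = y + w" by (simp add: w_def)
    have jw: "norm (j w) \<le> \<tau>" using ju by (simp add: w_def)
    have ny: "norm y < \<rho>" using y by simp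
    have "l t (j w) \<le> norm (l t) * norm (j w)" using norm_blinfun[of "l t" "j w"] by simp
    also have "\<dots> \<le> lm * 1" using l_le[OF t] jw \<tau> lm0 by (intro mult_mono) auto
    finally have 1: "l t (j w) \<le> lm" by simp
    have "A y y \<le> norm A * norm y * norm y"
      using norm_blinfun[of "A y" y] mult_right_mono[OF norm_blinfun[of A y] norm_ge_zero[of y]] by simp
    also have "\<dots> \<le> norm A * \<rho> * \<rho>" using ny \<rho> by (intro mult_mono mult_left_mono) auto
    finally have 2: "A y y \<le> norm A * \<rho>\<^sup>2" by (simp add: power2_eq_square mult.assoc)
    have lu: "l t (j u) = l t (j y) + l t (j w)" by (simp add: u blinfun.add_right)
    have "A u u / 2 \<le> E"
      using min diss_nonneg[of "u - y"] F_nonneg[of u] F_le[OF y] 1 2 lu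
      unfolding energy_def E_def by linarith
    then have "(norm u)\<^sup>2 \<le> 2 * E / \<alpha>" using \<alpha>(2)[of u] \<alpha>(1) by (simp add: field_simps)
    then have "norm u \<le> sqrt (2 * E / \<alpha>)" by (rule real_le_rsqrt)
    then have u\<sigma>: "norm u < \<sigma>" using \<rho> by (simp add: \<sigma>_def)
    obtain r where r: "0 < r" "r < 1" "F (y + w) - F y = DF (y + r *\<^sub>R w) (j w)"
      by (rule F_increment)
    have "norm (y + r *\<^sub>R w) = norm ((1 - r) *\<^sub>R y + r *\<^sub>R u)" by (simp add: u algebra_simps)
    also have "\<dots> \<le> (1 - r) * norm y + r * norm u"
      using norm_triangle_ineq[of "(1 - r) *\<^sub>R y" "r *\<^sub>R u"] r by simp
    also have "\<dots> < (1 - r) * \<sigma> + r * \<sigma>"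
      using ny u\<sigma> \<sigma>(2) r by (intro add_strict_mono mult_strict_left_mono) auto
    finally have yr: "y + r *\<^sub>R w \<in> ball 0 \<sigma>" by (simp add: algebra_simps)
    have "norm (DF (y + r *\<^sub>R w) - DF y) \<le> K * norm (y + r *\<^sub>R w - y)"
      using yr ny \<sigma> by (intro K) auto
    also have "\<dots> \<le> K * (1 * norm w)"
      unfolding add_diff_cancel_left' norm_scaleR using r K(1) by (intro mult_left_mono mult_right_mono) auto
    finally have d: "norm (DF (y + r *\<^sub>R w) - DF y) \<le> K * norm w" by simp
    have "- (DF (y + r *\<^sub>R w) - DF y) (j w) \<le> norm (DF (y + r *\<^sub>R w) - DF y) * norm (j w)"
      using norm_blinfun[of "DF (y + r *\<^sub>R w) - DF y" "j w"] by simp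
    also have "\<dots> \<le> K * norm w * \<tau>" using d jw K(1) by (intro mult_mono) auto
    finally have 3: "- (K * norm w * \<tau>) \<le> F (y + w) - F y - DF y (j w)"
      unfolding r(3) by (simp add: blinfun.diff_left)
    have "(load t - load s) w \<le> norm (load t - load s) * norm w"
      using norm_blinfun[of "load t - load s" w] by simp
    also have "\<dots> \<le> \<Lambda> * \<bar>t - s\<bar> * norm w" by (intro mult_right_mono load_lipschitz \<Lambda> s t) simp
    also have "\<dots> \<le> \<Lambda> * \<tau> * norm w" using st \<Lambda>0 by (intro mult_right_mono mult_left_mono) auto
    finally have 4: "(load t - load s) w \<le> \<Lambda> * \<tau> * norm w" .
    have 5: "(grad y - load t) w + A w w / 2 + (F (y + w) - F y - DF y (j w)) + diss w \<le> 0"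
      using min energy_increment[of t y w] by (simp add: w_def)
    \<comment> \<open>Stability of \<open>y\<close> at time \<open>s\<close> compensates the linear
      term by the dissipation, up to the change of the load from \<open>s\<close> to
      \<open>t\<close>.\<close>
    have "\<alpha> * (norm w)\<^sup>2 / 2 \<le> K * norm w * \<tau> + \<Lambda> * \<tau> * norm w"
      using \<alpha>(2)[of w] 3 4 5 spec[OF stable, of w] by (simp add: blinfun.diff_left)
    also have "\<dots> = (K + \<Lambda>) * \<tau> * norm w" by (simp add: algebra_simps)
    finally have "\<alpha> * norm w * norm w \<le> 2 * (K + \<Lambda>) * \<tau> * norm w"
      by (simp add: power2_eq_square algebra_simps)
    moreover have "0 \<le> \<tau>" using st by linarith
    ultimately have "\<alpha> * norm w \<le> 2 * (K + \<Lambda>) * \<tau>"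
      using K(1) \<Lambda>0 by (cases "w = 0") auto
    then show "norm (u - y) \<le> 2 * (K + \<Lambda>) / \<alpha> * \<tau>"
      using \<alpha>(1) by (simp add: w_def field_simps)
  qed
qed

section \<open>Consequences of minimality\<close>

text \<open>The segment from \<open>u\<close> to \<open>v\<close> satisfies the constraint by
  convexity. Minimality along it, combined with convexity of the dissipation, is divided by the
  parameter, which then tends to 0.\<close>

lemma variational_inequality:
  assumes min: "is_arg_min (\<lambda>u. energy j A F l t u + R (j (u - y))) (\<lambda>u. norm (j (u - y)) \<le> \<tau>) u"
    and v: "norm (j (v - y)) \<le> \<tau>"
  shows "diss (u - y) \<le> diss (v - y) + (grad u - load t) (v - u)"
proof -
  define E where "E = energy j A F l t"
  have u: "norm (j (u - y)) \<le> \<tau>"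
    and least: "\<And>x. norm (j (x - y)) \<le> \<tau> \<Longrightarrow> E u + diss (u - y) \<le> E x + diss (x - y)"
    using min by (auto simp: is_arg_min_def E_def diss_def not_less)
  let ?\<phi> = "\<lambda>s. E (u + s *\<^sub>R (v - u))"
  have "(?\<phi> has_real_derivative (grad u - load t) (v - u)) (at 0)"
    using energy_has_derivative[of t u] by (intro real_derivative_line) (simp add: E_def)
  then have "((\<lambda>s. (?\<phi> s - ?\<phi> 0) / (s - 0)) \<longlongrightarrow> (grad u - load t) (v - u)) (at 0)"
    unfolding has_field_derivative_iff by simp
  then have lim: "((\<lambda>s. (?\<phi> s - E u) / s) \<longlongrightarrow> (grad u - load t) (v - u)) (at_right 0)"
    by (auto intro: tendsto_mono[OF at_le])
  have ge: "diss (u - y) - diss (v - y) \<le> (?\<phi> s - E u) / s" if s: "0 < s" "s < 1" for s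
  proof -
    have eq: "u + s *\<^sub>R (v - u) - y = (1 - s) *\<^sub>R (u - y) + s *\<^sub>R (v - y)"
      by (simp add: algebra_simps)
    have "norm (j (u + s *\<^sub>R (v - u) - y)) \<le> (1 - s) * norm (j (u - y)) + s * norm (j (v - y))"
      unfolding eq blinfun.add_right blinfun.scaleR_right
      using norm_triangle_ineq[of "(1 - s) *\<^sub>R j (u - y)" "s *\<^sub>R j (v - y)"] s by simp
    also have "\<dots> \<le> (1 - s) * \<tau> + s * \<tau>" using u v s by (intro add_mono mult_left_mono) auto
    finally have "norm (j (u + s *\<^sub>R (v - u) - y)) \<le> \<tau>" by (simp add: algebra_simps)
    from least[OF this] have "E u + diss (u - y) \<le> ?\<phi> s + diss ((1 - s) *\<^sub>R (u - y) + s *\<^sub>R (v - y))"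
      unfolding eq .
    also have "diss ((1 - s) *\<^sub>R (u - y) + s *\<^sub>R (v - y)) \<le> (1 - s) * diss (u - y) + s * diss (v - y)"
      using diss_add[of "(1 - s) *\<^sub>R (u - y)" "s *\<^sub>R (v - y)"] s by (simp add: diss_scale)
    finally have "s * (diss (u - y) - diss (v - y)) \<le> ?\<phi> s - E u" by (simp add: algebra_simps)
    then show ?thesis using s by (simp add: field_simps)
  qed
  have "diss (u - y) - diss (v - y) \<le> (grad u - load t) (v - u)"
    using lim
  proof (rule tendsto_lowerbound)
    show "\<forall>\<^sub>F s in at_right 0. diss (u - y) - diss (v - y) \<le> (?\<phi> s - E u) / s"
      using ge by (intro eventually_at_rightI[of 0 1]) auto
  qed simp
  then show ?thesis by simp
qed

text \<open>The old state \<open>y\<close> is always an admissible competitor, so this half of the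
  inclusion holds even where the constraint is active.\<close>

lemma minimizer_dissipation:
  assumes min: "is_arg_min (\<lambda>u. energy j A F l t u + R (j (u - y))) (\<lambda>u. norm (j (u - y)) \<le> \<tau>) u"
    and \<tau>: "0 \<le> \<tau>"
  shows "diss (u - y) \<le> (load t - grad u) (u - y)"
  using variational_inequality[OF min, of y] \<tau> diss_scale[of 0 0]
  by (simp add: blinfun.zero_right blinfun.diff_left blinfun.diff_right)

lemma minimizer_stable:
  assumes min: "is_arg_min (\<lambda>u. energy j A F l t u + R (j (u - y))) (\<lambda>u. norm (j (u - y)) \<le> \<tau>) u"
    and inactive: "norm (j (u - y)) < \<tau>"
  shows "(load t - grad u) x \<le> diss x"
proof -
  \<comment> \<open>The length \<open>s\<close> of the variation stays within the slack of the
    constraint; the summand 1 keeps the denominator positive.\<close>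
  define s where "s = (\<tau> - norm (j (u - y))) / (norm (j x) + 1)"
  have nx: "0 < norm (j x) + 1" by (simp add: add_nonneg_pos)
  have s: "0 < s" "s * (norm (j x) + 1) = \<tau> - norm (j (u - y))"
    using inactive nx unfolding s_def by (auto intro!: divide_pos_pos)
  have "norm (j (u + s *\<^sub>R x - y)) \<le> norm (j (u - y)) + norm (j (s *\<^sub>R x))"
    using norm_triangle_ineq[of "j (u - y)" "j (s *\<^sub>R x)"] by (simp add: blinfun.add_right[symmetric] algebra_simps)
  also have "\<dots> \<le> norm (j (u - y)) + s * (norm (j x) + 1)"
    using s(1) by (simp add: blinfun.scaleR_right algebra_simps)
  also have "\<dots> = \<tau>" using s(2) by simp
  finally have "norm (j (u + s *\<^sub>R x - y)) \<le> \<tau>" .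
  from variational_inequality[OF min this]
  have "diss (u - y) \<le> diss ((u - y) + s *\<^sub>R x) + s * (grad u - load t) x"
    by (simp add: blinfun.scaleR_right algebra_simps)
  also have "diss ((u - y) + s *\<^sub>R x) \<le> diss (u - y) + s * diss x"
    using diss_add[of "u - y" "s *\<^sub>R x"] s(1) by (simp add: diss_scale)
  finally have "0 \<le> s * (diss x + (grad u - load t) x)" by (simp add: distrib_left)
  then have "0 \<le> diss x + (grad u - load t) x" using s(1) by (simp add: zero_le_mult_iff)
  then show ?thesis by (simp add: blinfun.diff_left)
qed

text \<open>Strong monotonicity of the gradient on the segment from \<open>y\<close> to
  \<open>u\<close>: combining stability at \<open>s\<close> with full dissipation at
  \<open>t\<close> eliminates the dissipation and leaves only the change of the load.\<close>

lemma convex_step_bound: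
  assumes convex: "\<And>a v. a \<in> cball c r \<Longrightarrow> \<kappa> * (norm v)\<^sup>2 \<le> hess a v v"
    and near: "norm (y - c) + norm (u - y) \<le> r"
    and stable: "(load s - grad y) (u - y) \<le> diss (u - y)"
    and diss: "diss (u - y) \<le> (load t - grad u) (u - y)"
    and load: "norm (load t - load s) \<le> b"
  shows "\<kappa> * norm (u - y) \<le> b"
proof (cases "u = y")
  case True
  then show ?thesis using order_trans[OF norm_ge_zero load] by simp
next
  case False
  define w where "w = u - y"
  let ?g = "\<lambda>s. grad (y + s *\<^sub>R w) w"
  have "(?g has_real_derivative hess (y + s *\<^sub>R w) w w) (at s)" for s
    by (rule real_derivative_line_blinfun[OF grad_has_derivative])
  then have "\<exists>q. 0 < q \<and> q < 1 \<and> ?g 1 - ?g 0 = (1 - 0) * hess (y + q *\<^sub>R w) w w"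
    by (intro MVT2) auto
  then obtain q where q: "0 < q" "q < 1" and g: "grad u w - grad y w = hess (y + q *\<^sub>R w) w w"
    by (auto simp: w_def)
  have "norm (y + q *\<^sub>R w - c) \<le> norm (y - c) + norm (q *\<^sub>R w)"
    using norm_triangle_ineq[of "y - c" "q *\<^sub>R w"] by (simp add: algebra_simps)
  also have "norm (q *\<^sub>R w) \<le> 1 * norm w" unfolding norm_scaleR using q by (intro mult_right_mono) auto
  finally have "y + q *\<^sub>R w \<in> cball c r" using near by (simp add: w_def dist_norm norm_minus_commute)
  from convex[OF this, of w] have "\<kappa> * (norm w)\<^sup>2 \<le> grad u w - grad y w" by (simp add: g)
  also have "\<dots> \<le> (load t - load s) w"
    using stable diss unfolding w_def[symmetric] by (simp add: blinfun.diff_left)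
  also have "\<dots> \<le> norm (load t - load s) * norm w"
    using norm_blinfun[of "load t - load s" w] by simp
  also have "\<dots> \<le> b * norm w" using load by (intro mult_right_mono) auto
  finally show ?thesis using False by (simp add: w_def power2_eq_square)
qed

end

section \<open>The convergence rate\<close>

theorem theorem3p24:
  fixes T \<kappa> \<Delta> \<delta> :: real
    and j :: "'z::{real_inner,complete_space} \<Rightarrow>\<^sub>L 'v::{real_inner,complete_space}"
    and jX :: "'v \<Rightarrow>\<^sub>L 'x::banach"
    and A :: "'z \<Rightarrow>\<^sub>L ('z \<Rightarrow>\<^sub>L real)"
    and F :: "'z \<Rightarrow> real"
    and DF :: "'z \<Rightarrow> ('v \<Rightarrow>\<^sub>L real)"
    and l l' :: "real \<Rightarrow> ('v \<Rightarrow>\<^sub>L real)"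
    and R :: "'v \<Rightarrow> real"
    and z0 :: 'z
    and z :: "real \<Rightarrow> 'z"
  assumes "rate_independent_system T j jX A F DF l R z0"
    and "\<exists>L. L-lipschitz_on {0..T} z"
    and "differential_solution T j A F l R z0 z"
    and "\<kappa> > 0" and "\<Delta> > 0"
    and "locally_uniformly_convex T j A F l \<kappa> \<Delta> z"
    and "0 < \<delta>" and "\<delta> \<le> \<kappa>"
    and "W1inf_deriv T l l'"
    and "lipschitz_const {0..T} l \<le> \<kappa> - \<delta>"
    and "BV_on {0..T} l'"
  shows "\<exists>K>0. \<exists>\<tau>0>0. \<forall>\<tau>. 0 < \<tau> \<and> \<tau> \<le> \<tau>0 \<longrightarrow>
           (\<forall>zs ts. incremental_scheme T j A F l R z0 \<tau> zs ts \<longrightarrow>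
              (\<forall>t\<in>{0..T}. norm (back_transformed_solution T zs ts t - z t) \<le> K * \<tau>))"
proof -
  interpret rate_independent_system T j jX A F DF l R z0 by (rule assms(1))
  define \<Lambda> where "\<Lambda> = lipschitz_const {0..T} l"
  have \<Lambda>: "\<Lambda>-lipschitz_on {0..T} l"
    unfolding \<Lambda>_def using l_Lipschitz by (rule lipschitz_on_lipschitz_const)
  have \<Lambda>0: "0 \<le> \<Lambda>" using \<Lambda> by (rule lipschitz_on_nonneg)
  have \<Lambda>_le: "\<Lambda> \<le> \<kappa> - \<delta>" using assms(10) by (simp add: \<Lambda>_def)
  obtain L where L: "L-lipschitz_on {0..T} z" using assms(2) by blast
  have L0: "0 \<le> L" using L by (rule lipschitz_on_nonneg)
  have z_lip: "norm (z t - z s) \<le> L * \<bar>t - s\<bar>" if "s \<in> {0..T}" "t \<in> {0..T}" for s t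
    using lipschitz_onD[OF L that(2,1)] by (simp add: dist_norm)
  have z_0: "z 0 = z0" using assms(3) by (auto simp: differential_solution_def)
  \<comment> \<open>The ball contains the \<open>\<Delta>\<close>-neighbourhood of the whole
    trajectory, and all local constants are taken on it. The summand 1 accounts for the ball being
    open.\<close>
  define \<rho> where "\<rho> = norm z0 + L * T + \<Delta> + 1"
  have \<rho>: "0 < \<rho>" using L0 T_pos assms(5) by (simp add: \<rho>_def add_nonneg_pos)
  have z_ball: "cball (z t) \<Delta> \<subseteq> ball 0 \<rho>" if t: "t \<in> {0..T}" for t
  proof
    fix u assume "u \<in> cball (z t) \<Delta>"
    then have "norm (u - z t) \<le> \<Delta>" by (simp add: dist_norm norm_minus_commute)
    moreover have "norm (z t - z 0) \<le> L * t" using z_lip[of 0 t] t by simp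
    moreover have "L * t \<le> L * T" using t L0 by (intro mult_left_mono) auto
    moreover have "norm u \<le> norm (u - z t) + norm (z t - z 0) + norm (z 0)"
      using norm_triangle_sub[of u "z t"] norm_triangle_sub[of "z t" "z 0"] by simp
    ultimately show "u \<in> ball 0 \<rho>" by (simp add: \<rho>_def z_0)
  qed
  have z_in_ball: "z t \<in> ball 0 \<rho>" if "t \<in> {0..T}" for t
    using z_ball[OF that] assms(5) by (meson centre_in_cball less_imp_le subsetD)
  have convex: "\<kappa> * (norm v)\<^sup>2 \<le> hess u v v" if "t \<in> {0..T}" "u \<in> cball (z t) \<Delta>" for t u v
    using assms(6) that unfolding locally_uniformly_convex_def D2_energy_eq by blast
  obtain C where C: "0 \<le> C" "\<And>a b v w. a \<in> ball 0 \<rho> \<Longrightarrow> b \<in> ball 0 \<rho> \<Longrightarrow>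
      \<bar>hess a v w - hess b v w\<bar> \<le> C * norm (a - b) * norm v * norm w"
    by (rule hess_locally_lipschitz[OF \<rho>]) (rule that)
  obtain M where M: "mono_on {0..T} M"
    "\<And>t v. t \<in> {0..T} \<Longrightarrow> (load t - grad (z t)) v \<le> diss v"
    "\<And>s r t. 0 \<le> s \<Longrightarrow> s \<le> r \<Longrightarrow> r \<le> t \<Longrightarrow> t \<le> T \<Longrightarrow>
      diss (z t - z s) \<le> (load r - grad (z r)) (z t - z s) + (t - s) * (M t - M s)"
    by (rule solution_properties[OF assms(3) L z_in_ball]) (assumption, rule that)
  have l_int: "(l' has_integral l t - l 0) {0..t}" if "t \<in> {0..T}" for t
    using assms(9) that by (auto simp: W1inf_deriv_def)
  obtain h V where V: "mono_on {0..T} V"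
    and slope: "\<And>a' a b b' c. 0 \<le> a' \<Longrightarrow> a' \<le> a \<Longrightarrow> a \<le> b \<Longrightarrow> b \<le> b' \<Longrightarrow> b' \<le> T \<Longrightarrow> c \<in> {a'..b'} \<Longrightarrow>
      norm (l b - l a - (b - a) *\<^sub>R h c) \<le> (b - a) * (V b' - V a')"
    by (rule BV_derivative_slopes[OF l_int assms(11)]) (assumption, rule that)
  interpret E: convex_evolution grad hess load "\<lambda>t. h t o\<^sub>L j" diss z V M T \<kappa> \<Delta> L \<Lambda> C \<rho>
  proof
    show "norm (load b - load a - (b - a) *\<^sub>R (h c o\<^sub>L j)) \<le> (b - a) * (V b' - V a')"
      if "0 \<le> a'" "a' \<le> a" "a \<le> b" "b \<le> b'" "b' \<le> T" "c \<in> {a'..b'}" for a' a b b' c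
    proof -
      have "load b - load a - (b - a) *\<^sub>R (h c o\<^sub>L j) = (l b - l a - (b - a) *\<^sub>R h c) o\<^sub>L j"
        by (rule blinfun_eqI) (simp add: load_def blinfun.diff_left blinfun.scaleR_left)
      then show ?thesis
        using slope[OF that] norm_blinfun_compose_embedding order_trans by metis
    qed
  qed (fact grad_has_derivative hess_sym C convex z_ball diss_add diss_scale load_lipschitz[OF \<Lambda>] V M z_lip
      assms(4,5) L0 \<Lambda>0)+
  obtain c where c: "0 \<le> c"
    and crude: "\<And>s t \<tau> y u. s \<in> {0..T} \<Longrightarrow> t \<in> {0..T} \<Longrightarrow> \<bar>t - s\<bar> \<le> \<tau> \<Longrightarrow> \<tau> \<le> 1 \<Longrightarrow> y \<in> ball 0 \<rho> \<Longrightarrow>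
      (\<forall>v. (load s - grad y) v \<le> diss v) \<Longrightarrow> norm (j (u - y)) \<le> \<tau> \<Longrightarrow>
      energy j A F l t u + diss (u - y) \<le> energy j A F l t y \<Longrightarrow> norm (u - y) \<le> c * \<tau>"
    by (rule constrained_step_bound[OF \<rho>]) (rule that)
  \<comment> \<open>The constant of \<open>discrete_error\<close> for
    \<open>D = \<kappa> / \<delta> * T\<close>: time advances by at least
    \<open>\<delta> / \<kappa> * \<tau>\<close> per step, so \<open>n\<close> steps satisfy
    \<open>n * \<tau> \<le> D\<close>.\<close>
  define K1 where "K1 = sqrt (exp (C * (1 + L) / \<kappa> * T) *
     (2 * (\<Lambda> + 2 * (V T - V 0) + C * (\<kappa> / \<delta> * T)) + 2 * (1 + L) * (2 * (V T - V 0) + C * (\<kappa> / \<delta> * T))) / \<kappa>)"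
  have "V 0 \<le> V T" using mono_onD[OF V, of 0 T] T_pos by simp
  then have K1: "0 \<le> K1"
    unfolding K1_def using \<Lambda>0 C(1) L0 T_pos assms(4,7) by simp
  \<comment> \<open>The error \<open>K1 * \<tau>\<close>, the crude step bound
    \<open>c * \<tau>\<close> and the reserve \<open>(1 + L) * \<tau>\<close> must fit together into
    \<open>\<Delta>\<close>; the bound 1 serves the crude estimate.\<close>
  define \<tau>0 where "\<tau>0 = min 1 (\<Delta> / (K1 + c + 1 + L))"
  have den: "0 < K1 + c + 1 + L" using K1 c L0 by simp
  have \<tau>0: "0 < \<tau>0" using den assms(5) by (simp add: \<tau>0_def)
  have main: "norm (back_transformed_solution T zs ts t - z t) \<le> (K1 + 1 + L) * \<tau>"
    if \<tau>: "0 < \<tau>" "\<tau> \<le> \<tau>0" and scheme: "incremental_scheme T j A F l R z0 \<tau> zs ts" and t: "t \<in> {0..T}"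
    for \<tau> zs ts t
  proof -
    have \<tau>1: "\<tau> \<le> 1" and "\<tau> \<le> \<Delta> / (K1 + c + 1 + L)" using \<tau>(2) by (auto simp: \<tau>0_def)
    then have "(K1 + c + 1 + L) * \<tau> \<le> \<Delta>" using den by (simp add: field_simps)
    then have near: "K1 * \<tau> + c * \<tau> + (1 + L) * \<tau> \<le> \<Delta>" by (simp add: algebra_simps)
    have cL: "0 \<le> c * \<tau>" "0 \<le> (1 + L) * \<tau>" "0 \<le> K1 * \<tau>" using c L0 K1 \<tau>(1) by simp_all
    have zs_0: "zs 0 = z0" and ts_0: "ts 0 = 0"
      using scheme by (auto simp: incremental_scheme_def)
    have argmin: "is_arg_min (\<lambda>u. energy j A F l (ts k) u + R (j (u - zs k)))
        (\<lambda>u. norm (j (u - zs k)) \<le> \<tau>) (zs (Suc k))"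
      and ts_Suc: "ts (Suc k) = min (ts k + \<tau> - norm (j (zs (Suc k) - zs k))) T" for k
      using scheme by (auto simp: incremental_scheme_def dest!: spec[of _ "Suc k"])
    have constraint: "norm (j (zs (Suc k) - zs k)) \<le> \<tau>" for k
      using argmin[of k] by (simp add: is_arg_min_def)
    have ts_le: "ts k \<le> T" for k using ts_0 T_pos ts_Suc by (cases k) auto
    have ts_step: "ts k \<le> ts (Suc k)" "ts (Suc k) \<le> ts k + \<tau>" for k
      using ts_Suc[of k] ts_le[of k] constraint[of k] norm_ge_zero[of "j (zs (Suc k) - zs k)"] by linarith+
    have ts_mono: "ts i \<le> ts k" if "i \<le> k" for i k
      by (rule lift_Suc_mono_le[where f = ts, OF ts_step(1) that])
    have ts_range: "ts k \<in> {0..T}" for k using ts_mono[of 0 k] ts_0 ts_le by simp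
    \<comment> \<open>One step from a state that is stable at time \<open>s\<close> and close to
      \<open>z s\<close>. In use \<open>s\<close> is the physical time preceding
      \<open>ts k\<close>, or 0 at the start.\<close>
    have step: "\<kappa> * norm (zs (Suc k) - zs k) \<le> (\<kappa> - \<delta>) * (ts k - s)"
        "diss (zs (Suc k) - zs k) \<le> (load (ts k) - grad (zs (Suc k))) (zs (Suc k) - zs k)"
        "\<And>v. (load (ts k) - grad (zs (Suc k))) v \<le> diss v"
      if s: "s \<in> {0..T}" "s \<le> ts k" "ts k - s \<le> \<tau>" and stable: "\<And>v. (load s - grad (zs k)) v \<le> diss v"
        and e: "norm (zs k - z s) \<le> K1 * \<tau>" for k s
    proof -
      show d: "diss (zs (Suc k) - zs k) \<le> (load (ts k) - grad (zs (Suc k))) (zs (Suc k) - zs k)"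
        using argmin less_imp_le[OF \<tau>(1)] by (rule minimizer_dissipation)
      have "zs k \<in> cball (z s) \<Delta>" using e near cL by (simp add: dist_norm norm_minus_commute)
      then have zk: "zs k \<in> ball 0 \<rho>" using z_ball[OF s(1)] by blast
      have "norm (j (zs k - zs k)) \<le> \<tau>" using \<tau>(1) by (simp add: blinfun.zero_right)
      then have "\<not> energy j A F l (ts k) (zs k) + R (j (zs k - zs k))
          < energy j A F l (ts k) (zs (Suc k)) + R (j (zs (Suc k) - zs k))"
        using argmin[of k] unfolding is_arg_min_def by blast
      then have "energy j A F l (ts k) (zs (Suc k)) + diss (zs (Suc k) - zs k) \<le> energy j A F l (ts k) (zs k)"
        by (simp add: diss_def R_0 blinfun.zero_right)
      \<comment> \<open>The crude bound comes first: it places the new state in the region of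
        convexity, where the sharp bound becomes available.\<close>
      then have "norm (zs (Suc k) - zs k) \<le> c * \<tau>"
        using s by (intro crude[where s = s and t = "ts k"] s(1) ts_range \<tau>1 zk allI stable constraint) auto
      then have "norm (zs k - z s) + norm (zs (Suc k) - zs k) \<le> \<Delta>" using e near cL by linarith
      then have "\<kappa> * norm (zs (Suc k) - zs k) \<le> \<Lambda> * (ts k - s)"
        using load_lipschitz[OF \<Lambda> s(1) ts_range[of k]] s(2)
        by (intro convex_step_bound[OF convex[OF s(1)] _ stable d]) auto
      also have "\<dots> \<le> (\<kappa> - \<delta>) * (ts k - s)" using \<Lambda>_le s by (intro mult_right_mono) auto
      finally show w: "\<kappa> * norm (zs (Suc k) - zs k) \<le> (\<kappa> - \<delta>) * (ts k - s)" .
      have "(\<kappa> - \<delta>) * (ts k - s) \<le> (\<kappa> - \<delta>) * \<tau>" using s assms(8) by (intro mult_left_mono) auto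
      \<comment> \<open>The gap \<open>\<delta>\<close> makes the constraint strict, which yields
        stability of the new iterate.\<close>
      also have "\<dots> < \<kappa> * \<tau>" using assms(7) \<tau>(1) by simp
      finally have "\<kappa> * norm (zs (Suc k) - zs k) < \<kappa> * \<tau>" using w by linarith
      then have "norm (zs (Suc k) - zs k) < \<tau>" using assms(4) by simp
      then have "norm (j (zs (Suc k) - zs k)) < \<tau>" using j_normalized le_less_trans by blast
      then show "(load (ts k) - grad (zs (Suc k))) v \<le> diss v" for v
        using minimizer_stable[OF argmin] by blast
    qed
    \<comment> \<open>The shift by one pairs \<open>zs (Suc i)\<close> with \<open>ts i\<close>, the
      time of the energy that it minimizes.\<close>
    let ?x = "\<lambda>i. zs (Suc i)"
    have error: "norm (zs (Suc n) - z (ts n)) \<le> K1 * \<tau>"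
      if "E.discrete_evolution \<tau> n ?x ts" "real n * (\<delta> * \<tau>) \<le> \<kappa> * ts n" for n
    proof -
      have "\<kappa> * ts n \<le> \<kappa> * T" using ts_le assms(4) by (intro mult_left_mono) auto
      then have "real n * \<tau> \<le> \<kappa> / \<delta> * T" using that(2) assms(7) by (simp add: field_simps)
      from E.discrete_error[OF that(1) this] show ?thesis by (simp only: K1_def)
    qed
    \<comment> \<open>Besides the discrete evolution the induction carries a step bound, which
      forces the next time to advance, and a step count, which \<open>error\<close>
      requires.\<close>
    have evolution: "E.discrete_evolution \<tau> n ?x ts \<and> \<kappa> * norm (zs (Suc n) - zs n) \<le> (\<kappa> - \<delta>) * \<tau> \<and>
        real n * (\<delta> * \<tau>) \<le> \<kappa> * ts n" if "ts n < T" for n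
      using that
    proof (induction n)
      case 0
      have st: "(load 0 - grad (zs 0)) v \<le> diss v" for v
        using zero_in_subdiff_plusD(1)[OF z0_stable, of v]
        by (simp add: D_energy_eq zs_0 blinfun.diff_left)
      have "norm (zs 0 - z 0) \<le> K1 * \<tau>" using cL by (simp add: zs_0 z_0)
      note s0 = step[of 0 0, OF _ _ _ st this]
      \<comment> \<open>At the start the load has not changed yet, so the first iterate stays at
        \<open>z0\<close>.\<close>
      have "\<kappa> * norm (zs (Suc 0) - zs 0) \<le> (\<kappa> - \<delta>) * (ts 0 - 0)"
        using T_pos \<tau>(1) by (intro s0(1)) (auto simp: ts_0)
      then have "\<kappa> * norm (zs (Suc 0) - zs 0) \<le> 0" by (simp add: ts_0)
      then have zs1: "zs (Suc 0) = z0" using assms(4) by (simp add: mult_le_0_iff zs_0)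
      have "(load 0 - grad z0) v \<le> diss v" for v using st by (simp add: zs_0)
      then show ?case
        using \<tau>(1) T_pos assms(8) by (simp add: E.discrete_evolution_def zs1 z_0 zs_0 ts_0)
    next
      case (Suc n)
      then have "ts n < T" using ts_step(1)[of n] by linarith
      with Suc.IH have ev: "E.discrete_evolution \<tau> n ?x ts"
        and w: "\<kappa> * norm (zs (Suc n) - zs n) \<le> (\<kappa> - \<delta>) * \<tau>"
        and count: "real n * (\<delta> * \<tau>) \<le> \<kappa> * ts n" by auto
      have e: "norm (zs (Suc n) - z (ts n)) \<le> K1 * \<tau>" by (rule error[OF ev count])
      \<comment> \<open>Since \<open>ts (Suc n) < T\<close>, the cut-off at \<open>T\<close> is
        inactive and the part of \<open>\<tau>\<close> left by the step goes entirely into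
        time.\<close>
      have "ts (Suc n) - ts n = \<tau> - norm (j (zs (Suc n) - zs n))"
        using ts_Suc[of n] Suc.prems by simp
      then have "\<kappa> * (ts (Suc n) - ts n) \<ge> \<kappa> * \<tau> - \<kappa> * norm (zs (Suc n) - zs n)"
        using mult_left_mono[OF j_normalized[of "zs (Suc n) - zs n"], of \<kappa>] assms(4)
        by (simp add: right_diff_distrib)
      with w have adv: "\<delta> * \<tau> \<le> \<kappa> * (ts (Suc n) - ts n)" by (simp add: algebra_simps)
      have "0 < \<delta> * \<tau>" using assms(7) \<tau>(1) by simp
      with adv have "0 < \<kappa> * (ts (Suc n) - ts n)" by linarith
      then have less: "ts n < ts (Suc n)" using assms(4) by (simp add: zero_less_mult_iff)
      have st: "(load (ts n) - grad (zs (Suc n))) v \<le> diss v" for v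
        using E.discrete_stable[OF ev, of n v] by simp
      have s: "ts n \<in> {0..T}" "ts n \<le> ts (Suc n)" "ts (Suc n) - ts n \<le> \<tau>"
        using ts_range ts_step[of n] by auto
      note next_step = step[OF s st e]
      have h: "(\<kappa> - \<delta>) * (ts (Suc n) - ts n) \<le> \<kappa> * (ts (Suc n) - ts n)"
        using less assms(7) by (intro mult_right_mono) auto
      have w1: "norm (zs (Suc (Suc n)) - zs (Suc n)) \<le> ts (Suc n) - ts n"
        using order_trans[OF next_step(1) h] assms(4) by simp
      have "(\<kappa> - \<delta>) * (ts (Suc n) - ts n) \<le> (\<kappa> - \<delta>) * \<tau>"
        using s(3) assms(8) by (intro mult_left_mono) auto
      with next_step(1) have w2: "\<kappa> * norm (zs (Suc (Suc n)) - zs (Suc n)) \<le> (\<kappa> - \<delta>) * \<tau>" by linarith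
      have e': "norm (zs (Suc n) - z (ts n)) + (1 + L) * \<tau> \<le> \<Delta>" using e near cL by linarith
      have "E.discrete_evolution \<tau> (Suc n) ?x ts"
        using ev less ts_step(2)[of n] w1 next_step(2,3) e' ts_le[of "Suc n"]
        unfolding E.discrete_evolution_def by (auto simp: less_Suc_eq le_Suc_eq)
      moreover have "real (Suc n) * (\<delta> * \<tau>) \<le> \<kappa> * ts (Suc n)"
        using count adv by (simp add: algebra_simps)
      ultimately show ?case using w2 by blast
    qed
    have node: "norm (zs (Suc m) - z (ts m)) \<le> K1 * \<tau>" "norm (zs (Suc m) - zs m) \<le> \<tau>" if "ts m < T" for m
    proof -
      have ev: "E.discrete_evolution \<tau> m ?x ts" "\<kappa> * norm (zs (Suc m) - zs m) \<le> (\<kappa> - \<delta>) * \<tau>"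
        "real m * (\<delta> * \<tau>) \<le> \<kappa> * ts m" using evolution[OF that] by auto
      show "norm (zs (Suc m) - z (ts m)) \<le> K1 * \<tau>" by (rule error[OF ev(1,3)])
      have "(\<kappa> - \<delta>) * \<tau> \<le> \<kappa> * \<tau>" using assms(7) \<tau>(1) by simp
      with ev(2) show "norm (zs (Suc m) - zs m) \<le> \<tau>"
        using assms(4) by (metis mult_le_cancel_left_pos order_trans)
    qed

    \<comment> \<open>Transfer from the nodes to the interpolant\<close>
    have near_node: "norm (zs (Suc m) - z t) \<le> (K1 + L) * \<tau>" if m: "ts m < T" "ts m \<le> t" "t \<le> ts (Suc m)" for m
    proof -
      have "norm (z t - z (ts m)) \<le> L * \<bar>t - ts m\<bar>" using ts_range t by (intro z_lip)
      also have "\<dots> \<le> L * \<tau>" using m ts_step(2)[of m] L0 by (intro mult_left_mono) auto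
      finally have "norm (z t - z (ts m)) \<le> L * \<tau>" .
      moreover have "norm (zs (Suc m) - z t) \<le> norm (zs (Suc m) - z (ts m)) + norm (z t - z (ts m))"
        using norm_triangle_ineq4[of "zs (Suc m) - z (ts m)" "z t - z (ts m)"] by simp
      ultimately show ?thesis using node(1)[OF m(1)] by (simp add: distrib_right)
    qed
    \<comment> \<open>Otherwise the step count would bound every index by
      \<open>\<kappa> * T / (\<delta> * \<tau>)\<close>.\<close>
    have "\<exists>k. ts k = T"
    proof (rule ccontr)
      assume "\<nexists>k. ts k = T"
      then have "ts k < T" for k using ts_le[of k] by (metis order_le_less)
      then have "real k * (\<delta> * \<tau>) \<le> \<kappa> * ts k" for k using evolution by blast
      then have "real k * (\<delta> * \<tau>) \<le> \<kappa> * T" for k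
        using mult_left_mono[OF ts_le less_imp_le[OF assms(4)]] by (rule order_trans)
      moreover have "0 < \<delta> * \<tau>" using assms(7) \<tau>(1) by simp
      ultimately show False using reals_Archimedean3[of "\<delta> * \<tau>"] by (meson not_le)
    qed
    define N where "N = final_index T ts"
    have ts_N: "ts N = T"
      unfolding N_def final_index_def using \<open>\<exists>k. ts k = T\<close> by (rule LeastI_ex)
    have before: "ts k < T" if "k < N" for k
      using not_less_Least[of k "\<lambda>k. ts k = T"] that ts_le[of k] unfolding N_def final_index_def by linarith
    show ?thesis
    proof (cases "t = T")
      case True
      have "N \<noteq> 0" using ts_N ts_0 T_pos by (cases "N = 0") auto
      then obtain m where m: "N = Suc m" by (cases N) auto
      have "norm (zs (Suc m) - z t) \<le> (K1 + L) * \<tau>"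
        using before[of m] m ts_N True ts_le[of m] by (intro near_node) auto
      then show ?thesis
        using True \<tau>(1) by (simp add: back_transformed_solution_def N_def[symmetric] m distrib_right)
    next
      case False
      then have tT: "t < T" using t by simp
      \<comment> \<open>The first node beyond \<open>t\<close> determines the half-open interval
        that the definition of the interpolant selects.\<close>
      define k where "k = (LEAST k. t < ts k)"
      have "t < ts N" using tT ts_N by simp
      then have tk: "t < ts k" and kN: "k \<le> N"
        unfolding k_def by (rule LeastI, rule Least_le)
      have "k \<noteq> 0" using tk ts_0 t by (cases "k = 0") auto
      then obtain m where m: "k = Suc m" by (cases k) auto
      have tm: "ts m \<le> t" using not_less_Least[of m "\<lambda>k. t < ts k"] m by (simp add: k_def)
      have "(THE k. 1 \<le> k \<and> k \<le> N \<and> t \<in> {ts (k - 1)..<ts k}) = Suc m"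
      proof (rule the_equality)
        show "1 \<le> Suc m \<and> Suc m \<le> N \<and> t \<in> {ts (Suc m - 1)..<ts (Suc m)}"
          using kN tk tm m by simp
        fix i assume i: "1 \<le> i \<and> i \<le> N \<and> t \<in> {ts (i - 1)..<ts i}"
        have "\<not> i < Suc m" using ts_mono[of i m] tm i by auto
        moreover have "\<not> Suc m < i"
        proof
          assume "Suc m < i"
          then have "ts (Suc m) \<le> ts (i - 1)" by (intro ts_mono) simp
          then show False using tk i m by simp
        qed
        ultimately show "i = Suc m" by simp
      qed
      then have eq: "back_transformed_solution T zs ts t
          = zs m + ((t - ts m) / (ts (Suc m) - ts m)) *\<^sub>R (zs (Suc m) - zs m)"
        using False by (simp add: back_transformed_solution_def N_def[symmetric])
      define \<theta> where "\<theta> = (t - ts m) / (ts (Suc m) - ts m)"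
      have \<theta>: "0 \<le> \<theta>" "\<theta> \<le> 1" using tm tk m by (auto simp: \<theta>_def)
      have tmT: "ts m < T" using before[of m] kN m by simp
      \<comment> \<open>The interpolant is measured from its right endpoint
        \<open>zs (Suc m)\<close>, the iterate whose distance to \<open>z (ts m)\<close> is
        controlled.\<close>
      have "back_transformed_solution T zs ts t - z t = (zs (Suc m) - z t) - (1 - \<theta>) *\<^sub>R (zs (Suc m) - zs m)"
        unfolding eq \<theta>_def[symmetric] by (simp add: algebra_simps)
      then have "norm (back_transformed_solution T zs ts t - z t)
          \<le> norm (zs (Suc m) - z t) + norm ((1 - \<theta>) *\<^sub>R (zs (Suc m) - zs m))"
        by (simp only: norm_triangle_ineq4)
      also have "norm (zs (Suc m) - z t) \<le> (K1 + L) * \<tau>"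
        using tm tk m by (intro near_node tmT) auto
      also have "norm ((1 - \<theta>) *\<^sub>R (zs (Suc m) - zs m)) \<le> 1 * \<tau>"
        unfolding norm_scaleR using \<theta> node(2)[OF tmT] by (intro mult_mono) auto
      finally show ?thesis by (simp add: algebra_simps)
    qed
  qed
  have "0 < K1 + 1 + L" using K1 L0 by simp
  then show ?thesis using main \<tau>0 by blast
qed

end
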